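(* The following contra-collection principle is $\mathcal I^{\mathrm{cb}}$-interpretable: $$\forall k^{\mathbb N}\,\exists f\le_{\mathbb N\to\mathbb N}1\ \forall n\le k\,C(f,n)\ \to\ \exists f\le_{\mathbb N\to\mathbb N}1\ \forall n^{\mathbb N}\,C(f,n),$$ provided that $C(f,n)$ (a formula of the language of $\mathrm{HA}^\omega$) has no positive $\mathcal I$-witnesses.
   Context: Source. $\mathrm{HA}^\omega$ is Heyting arithmetic in all finite types generated by $\sigma\to\tau$ from ground types $\mathbb N$ and $\mathbb B$ (Booleans), with combinators, $0$, successor, recursors, Boolean constants and conditionals; its only relation symbols are logical equalities $\equiv_\sigma$. Formulas use $\bot,\wedge,\to,\forall x^\sigma,\exists x^\sigma$ and the following primitive restricted quantifiers. $n\le k$ abbreviates a quantifier-free equation of type $\mathbb N$. $\forall n\le k\,A$, $\exists n\le k\,A$ are axiomatized as equivalent to $\forall n(n\le k\to A)$, $\exists n(n\le k\wedge A)$; $\forall f\le_{\mathbb N\to\mathbb N}1\,A$, $\exists f\le_{\mathbb N\to\mathbb N}1\,A$ are axiomatized as equivalent to $\forall f^{\mathbb N\to\mathbb N}(\forall n^{\mathbb N}(fn\le1)\to A)$, $\exists f^{\mathbb N\to\mathbb N}(\forall n^{\mathbb N}(fn\le1)\wedge A)$. Target. Target language: the language of $\mathrm{HA}^\omega$ with the extra type constructor $\sigma\mapsto\sigma^*$ (non-empty finite subsets) and constants for singleton, union, indexed union, membership, combinators and recursors for all these types, and $\mathrm m:\mathbb N^*\to\mathbb N$ (maximum). $\mathcal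 S^\omega_*$: $\mathcal S_{\mathbb N}=\mathbb N$, $\mathcal S_{\mathbb B}=\{0,1\}$, $\mathcal S_{\rho\to\sigma}$ all functions, $\mathcal S_{\sigma^*}$ all non-empty finite subsets of $\mathcal S_\sigma$. The target theory $T$ is the set of sentences true in $\mathcal S^\omega_*$. Witnessing types are generated from $\mathbb N$ by $\to$ and $*$; witnessing terms are terms of such types. $\mathcal L^{\mathcal I}$ adds to the language of $\mathrm{HA}^\omega$ (without restricted quantifiers) a unary predicate $\mathcal I_\sigma(x^\sigma)$ for each type. Boldface letters are (possibly empty) tuples; $\forall\boldsymbol b\in\boldsymbol B$ is componentwise. $\mathcal I^{\mathrm{cb}}$ (canonical upon bounding): $\langle\mathcal I_{\mathbb N}(x)\rangle^n$ is $x\le n$; $\langle\mathcal I_{\mathbb B}(i)\rangle$ is true, without witnesses; $\langle\mathcal I_{\rho\to\sigma}(h)\rangle^{\boldsymbol f,\boldsymbol g}_{\boldsymbol a,\boldsymbol d}:\equiv\forall x^\rho(\forall\boldsymbol b\in\boldsymbol g\boldsymbol a\boldsymbol d\,\langle\mathcal I_\rho(x)\rangle^{\boldsymbol a}_{\boldsymbol b}\to\langle\mathcal I_\sigma(hx)\rangle^{\boldsymbol f\boldsymbol a}_{\boldsymbol d})$. $\mathcal U$-interpretation: $\langle x\equiv_\sigma y\rangle$ is $x=y$; $\langle\bot\rangle:\equiv\bot$; $\langle A\wedge B\rangle^{\boldsymbol a,\boldsymbol c}_{\boldsymbol b,\boldsymbol d}:\equiv\langle A\rangle^{\boldsymbol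 a}_{\boldsymbol b}\wedge\langle B\rangle^{\boldsymbol c}_{\boldsymbol d}$; $\langle A\to B\rangle^{\boldsymbol f,\boldsymbol g}_{\boldsymbol a,\boldsymbol d}:\equiv\forall\boldsymbol b\in\boldsymbol g\boldsymbol a\boldsymbol d\,\langle A\rangle^{\boldsymbol a}_{\boldsymbol b}\to\langle B\rangle^{\boldsymbol f\boldsymbol a}_{\boldsymbol d}$; $\langle\forall xA\rangle^{\boldsymbol a}_{\boldsymbol b}:\equiv\forall x\langle A\rangle^{\boldsymbol a}_{\boldsymbol b}$; $\langle\exists xA\rangle^{\boldsymbol a}_{\boldsymbol B}:\equiv\exists x\forall\boldsymbol b\in\boldsymbol B\langle A\rangle^{\boldsymbol a}_{\boldsymbol b}$. $A(\boldsymbol x)$ is $\mathcal U$-interpretable if there are closed witnessing terms $\boldsymbol t$ with $T\vdash\forall\boldsymbol b\langle A(\boldsymbol x)\rangle^{\boldsymbol t}_{\boldsymbol b}$. Relativization: $A^{\mathcal I}$ commutes with connectives; $(\forall x^\sigma A)^{\mathcal I}:\equiv\forall x^\sigma(\mathcal I_\sigma(x)\to A^{\mathcal I})$; $(\exists x^\sigma A)^{\mathcal I}:\equiv\exists x^\sigma(\mathcal I_\sigma(x)\wedge A^{\mathcal I})$; for restricted quantifiers with restricting formula $B(x)$ (namely $n\le k$, resp. $\forall n(fn\le1)$), the quantifier is relativized to $B^{\mathcal I}$ only: $\forall x(B(x)^{\mathcal I}\to A^{\mathcal I})$, $\exists x(B(x)^{\mathcal I}\wedge A^{\mathcal I})$,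 where $(n\le k)^{\mathcal I}$ is $n\le k$ and $(\forall n(fn\le1))^{\mathcal I}$ is $\forall n(\mathcal I_{\mathbb N}(n)\to fn\le1)$. Write $|A|^{\boldsymbol a}_{\boldsymbol b}:\equiv\langle A^{\mathcal I}\rangle^{\boldsymbol a}_{\boldsymbol b}$; $A$ has no positive $\mathcal I$-witnesses if the tuple $\boldsymbol a$ is empty. A formula $A(\boldsymbol x)$ is $\mathcal I^{\mathrm{cb}}$-interpretable if $\forall\boldsymbol x(\mathcal I(\boldsymbol x)\to A(\boldsymbol x)^{\mathcal I})$ is $\mathcal U$-interpretable. *)

theory Defs
  imports Main "HOL-Library.FuncSet"
begin

section \<open>Types and terms\<close>

text \<open>One datatype of types serves both languages: the types of the source system are the
  star-free ones, the target language uses all of them.  \<^term>\<open>Star\<close> forms the type of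
  non-empty finite subsets.\<close>

datatype ty = tyN | tyB | Arr ty ty (infixr "\<rightarrow>" 65) | Star ty

primrec star_free :: "ty \<Rightarrow> bool" where
  "star_free tyN = True"
| "star_free tyB = True"
| "star_free (\<rho> \<rightarrow> \<sigma>) = (star_free \<rho> \<and> star_free \<sigma>)"
| "star_free (Star \<sigma>) = False"

primrec witnessing_ty :: "ty \<Rightarrow> bool" where
  "witnessing_ty tyN = True"
| "witnessing_ty tyB = False"
| "witnessing_ty (\<rho> \<rightarrow> \<sigma>) = (witnessing_ty \<rho> \<and> witnessing_ty \<sigma>)"
| "witnessing_ty (Star \<sigma>) = witnessing_ty \<sigma>"

datatype const =
    cK ty ty | cS ty ty ty
  | cZero | cSucc | cRec ty
  | cTrue | cFalse | cCond ty
  | cSing ty | cUnion ty | cIUnion ty ty | cMem ty | cMax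

primrec const_ty :: "const \<Rightarrow> ty" where
  "const_ty (cK \<rho> \<sigma>) = \<rho> \<rightarrow> \<sigma> \<rightarrow> \<rho>"
| "const_ty (cS \<rho> \<sigma> \<tau>) = (\<rho> \<rightarrow> \<sigma> \<rightarrow> \<tau>) \<rightarrow> (\<rho> \<rightarrow> \<sigma>) \<rightarrow> \<rho> \<rightarrow> \<tau>"
| "const_ty cZero = tyN"
| "const_ty cSucc = tyN \<rightarrow> tyN"
| "const_ty (cRec \<sigma>) = \<sigma> \<rightarrow> (tyN \<rightarrow> \<sigma> \<rightarrow> \<sigma>) \<rightarrow> tyN \<rightarrow> \<sigma>"
| "const_ty cTrue = tyB"
| "const_ty cFalse = tyB"
| "const_ty (cCond \<sigma>) = tyB \<rightarrow> \<sigma> \<rightarrow> \<sigma> \<rightarrow> \<sigma>"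
| "const_ty (cSing \<sigma>) = \<sigma> \<rightarrow> Star \<sigma>"
| "const_ty (cUnion \<sigma>) = Star \<sigma> \<rightarrow> Star \<sigma> \<rightarrow> Star \<sigma>"
| "const_ty (cIUnion \<rho> \<sigma>) = Star \<rho> \<rightarrow> (\<rho> \<rightarrow> Star \<sigma>) \<rightarrow> Star \<sigma>"
| "const_ty (cMem \<sigma>) = \<sigma> \<rightarrow> Star \<sigma> \<rightarrow> tyB"
| "const_ty cMax = Star tyN \<rightarrow> tyN"

text \<open>Variables are de Bruijn indices (terms are combinatory, so only formulas bind).  A context
  is a list of types; index \<open>i\<close> has the type at position \<open>i\<close>.\<close>

datatype tm = Var nat | Con const | App tm tm (infixl "\<bullet>" 90)

inductive typed :: "ty list \<Rightarrow> tm \<Rightarrow> ty \<Rightarrow> bool" where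
  "i < length \<Gamma> \<Longrightarrow> typed \<Gamma> (Var i) (\<Gamma> ! i)"
| "typed \<Gamma> (Con c) (const_ty c)"
| "typed \<Gamma> s (\<rho> \<rightarrow> \<sigma>) \<Longrightarrow> typed \<Gamma> t \<rho> \<Longrightarrow> typed \<Gamma> (s \<bullet> t) \<sigma>"

text \<open>The type of each set constant involves \<^term>\<open>Star\<close>, so the constants of star-free type
  are exactly those of the source system.\<close>

primrec source_tm :: "tm \<Rightarrow> bool" where
  "source_tm (Var i) = True"
| "source_tm (Con c) = star_free (const_ty c)"
| "source_tm (s \<bullet> t) = (source_tm s \<and> source_tm t)"

text \<open>\<open>up r\<close> is the renaming \<open>r\<close> carried under one binder.\<close>

definition up :: "(nat \<Rightarrow> nat) \<Rightarrow> nat \<Rightarrow> nat" where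
  "up r = case_nat 0 (\<lambda>i. Suc (r i))"

primrec ren :: "(nat \<Rightarrow> nat) \<Rightarrow> tm \<Rightarrow> tm" where
  "ren r (Var i) = Var (r i)"
| "ren r (Con c) = Con c"
| "ren r (s \<bullet> t) = ren r s \<bullet> ren r t"

definition shift :: "nat \<Rightarrow> tm \<Rightarrow> tm" where
  "shift m = ren (\<lambda>i. i + m)"

definition apps :: "tm \<Rightarrow> tm list \<Rightarrow> tm" where
  "apps t ts = foldl App t ts"

text \<open>Truncated subtraction: the predecessor is \<open>R 0 (\<lambda>n r. n)\<close>, and \<open>s - t\<close> iterates it
  \<open>t\<close> times on \<open>s\<close>.  The formula \<open>s \<le> t\<close> will be the equation \<open>s - t \<equiv> 0\<close>.\<close>

definition pred_tm :: tm where
  "pred_tm = Con (cRec tyN) \<bullet> Con cZero \<bullet> Con (cK tyN tyN)"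

definition monus :: "tm \<Rightarrow> tm \<Rightarrow> tm" where
  "monus s t = Con (cRec tyN) \<bullet> s \<bullet> (Con (cK (tyN \<rightarrow> tyN) tyN) \<bullet> pred_tm) \<bullet> t"

definition one_tm :: tm where
  "one_tm = Con cSucc \<bullet> Con cZero"

section \<open>Source formulas\<close>

text \<open>\<open>SAllLe t A\<close> and \<open>SExLe t A\<close> are the quantifiers over \<open>n \<le> t\<close>; they bind \<open>n\<close> in
  \<open>A\<close> but not in \<open>t\<close>.  \<open>SAllLe1 A\<close> and \<open>SExLe1 A\<close> are the quantifiers over \<open>f \<le> 1\<close> of
  type \<^term>\<open>tyN \<rightarrow> tyN\<close>.\<close>

datatype sfm =
    SBot | SEq ty tm tm | SAnd sfm sfm | SImp sfm sfm | SAll ty sfm | SEx ty sfm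
  | SAllLe tm sfm | SExLe tm sfm | SAllLe1 sfm | SExLe1 sfm

primrec swf :: "ty list \<Rightarrow> sfm \<Rightarrow> bool" where
  "swf \<Gamma> SBot = True"
| "swf \<Gamma> (SEq \<sigma> s t) =
    (star_free \<sigma> \<and> source_tm s \<and> typed \<Gamma> s \<sigma> \<and> source_tm t \<and> typed \<Gamma> t \<sigma>)"
| "swf \<Gamma> (SAnd A B) = (swf \<Gamma> A \<and> swf \<Gamma> B)"
| "swf \<Gamma> (SImp A B) = (swf \<Gamma> A \<and> swf \<Gamma> B)"
| "swf \<Gamma> (SAll \<sigma> A) = (star_free \<sigma> \<and> swf (\<sigma> # \<Gamma>) A)"
| "swf \<Gamma> (SEx \<sigma> A) = (star_free \<sigma> \<and> swf (\<sigma> # \<Gamma>) A)"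
| "swf \<Gamma> (SAllLe t A) = (source_tm t \<and> typed \<Gamma> t tyN \<and> swf (tyN # \<Gamma>) A)"
| "swf \<Gamma> (SExLe t A) = (source_tm t \<and> typed \<Gamma> t tyN \<and> swf (tyN # \<Gamma>) A)"
| "swf \<Gamma> (SAllLe1 A) = swf ((tyN \<rightarrow> tyN) # \<Gamma>) A"
| "swf \<Gamma> (SExLe1 A) = swf ((tyN \<rightarrow> tyN) # \<Gamma>) A"

primrec sren :: "(nat \<Rightarrow> nat) \<Rightarrow> sfm \<Rightarrow> sfm" where
  "sren r SBot = SBot"
| "sren r (SEq \<sigma> s t) = SEq \<sigma> (ren r s) (ren r t)"
| "sren r (SAnd A B) = SAnd (sren r A) (sren r B)"
| "sren r (SImp A B) = SImp (sren r A) (sren r B)"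
| "sren r (SAll \<sigma> A) = SAll \<sigma> (sren (up r) A)"
| "sren r (SEx \<sigma> A) = SEx \<sigma> (sren (up r) A)"
| "sren r (SAllLe t A) = SAllLe (ren r t) (sren (up r) A)"
| "sren r (SExLe t A) = SExLe (ren r t) (sren (up r) A)"
| "sren r (SAllLe1 A) = SAllLe1 (sren (up r) A)"
| "sren r (SExLe1 A) = SExLe1 (sren (up r) A)"

section \<open>Formulas with the predicates I, and relativization\<close>

datatype ifm =
    IBot | IEq ty tm tm | IPred ty tm | IAnd ifm ifm | IImp ifm ifm | IAll ty ifm | IEx ty ifm

primrec iren :: "(nat \<Rightarrow> nat) \<Rightarrow> ifm \<Rightarrow> ifm" where
  "iren r IBot = IBot"
| "iren r (IEq \<sigma> s t) = IEq \<sigma> (ren r s) (ren r t)"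
| "iren r (IPred \<sigma> t) = IPred \<sigma> (ren r t)"
| "iren r (IAnd A B) = IAnd (iren r A) (iren r B)"
| "iren r (IImp A B) = IImp (iren r A) (iren r B)"
| "iren r (IAll \<sigma> A) = IAll \<sigma> (iren (up r) A)"
| "iren r (IEx \<sigma> A) = IEx \<sigma> (iren (up r) A)"

definition ishift :: "nat \<Rightarrow> ifm \<Rightarrow> ifm" where
  "ishift m = iren (\<lambda>i. i + m)"

definition ile :: "tm \<Rightarrow> tm \<Rightarrow> ifm" where
  "ile s t = IEq tyN (monus s t) (Con cZero)"

text \<open>\<open>f \<le> 1\<close> relativized, with \<open>f\<close> the variable of index 0.\<close>

definition ile1 :: ifm where
  "ile1 = IAll tyN (IImp (IPred tyN (Var 0)) (ile (Var 1 \<bullet> Var 0) one_tm))"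

primrec rel :: "sfm \<Rightarrow> ifm" where
  "rel SBot = IBot"
| "rel (SEq \<sigma> s t) = IEq \<sigma> s t"
| "rel (SAnd A B) = IAnd (rel A) (rel B)"
| "rel (SImp A B) = IImp (rel A) (rel B)"
| "rel (SAll \<sigma> A) = IAll \<sigma> (IImp (IPred \<sigma> (Var 0)) (rel A))"
| "rel (SEx \<sigma> A) = IEx \<sigma> (IAnd (IPred \<sigma> (Var 0)) (rel A))"
| "rel (SAllLe t A) = IAll tyN (IImp (ile (Var 0) (shift 1 t)) (rel A))"
| "rel (SExLe t A) = IEx tyN (IAnd (ile (Var 0) (shift 1 t)) (rel A))"
| "rel (SAllLe1 A) = IAll (tyN \<rightarrow> tyN) (IImp ile1 (rel A))"
| "rel (SExLe1 A) = IEx (tyN \<rightarrow> tyN) (IAnd ile1 (rel A))"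

section \<open>Target formulas\<close>

datatype tfm =
    TBot | TEq ty tm tm | TAnd tfm tfm | TImp tfm tfm | TAll ty tfm | TEx ty tfm

primrec twf :: "ty list \<Rightarrow> tfm \<Rightarrow> bool" where
  "twf \<Gamma> TBot = True"
| "twf \<Gamma> (TEq \<sigma> s t) = (typed \<Gamma> s \<sigma> \<and> typed \<Gamma> t \<sigma>)"
| "twf \<Gamma> (TAnd A B) = (twf \<Gamma> A \<and> twf \<Gamma> B)"
| "twf \<Gamma> (TImp A B) = (twf \<Gamma> A \<and> twf \<Gamma> B)"
| "twf \<Gamma> (TAll \<sigma> A) = twf (\<sigma> # \<Gamma>) A"
| "twf \<Gamma> (TEx \<sigma> A) = twf (\<sigma> # \<Gamma>) A"

definition tle :: "tm \<Rightarrow> tm \<Rightarrow> tfm" where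
  "tle s t = TEq tyN (monus s t) (Con cZero)"

definition tmem :: "ty \<Rightarrow> tm \<Rightarrow> tm \<Rightarrow> tfm" where
  "tmem \<sigma> s t = TEq tyB (Con (cMem \<sigma>) \<bullet> s \<bullet> t) (Con cTrue)"

text \<open>Universal quantification over a tuple whose \<open>i\<close>-th component is \<^term>\<open>Var i\<close> in the body,
  first without and then with componentwise bounds; the bounds \<open>Bs\<close> are terms of the context
  outside the quantifiers.\<close>

primrec talls :: "ty list \<Rightarrow> tfm \<Rightarrow> tfm" where
  "talls [] A = A"
| "talls (\<sigma> # \<sigma>s) A = talls \<sigma>s (TAll \<sigma> A)"

definition vars :: "nat \<Rightarrow> tm list" where
  "vars m = map Var [0..<m]"

definition tballs :: "ty list \<Rightarrow> tm list \<Rightarrow> tfm \<Rightarrow> tfm" where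
  "tballs \<sigma>s Bs A = (let m = length \<sigma>s in
     talls \<sigma>s (foldr (\<lambda>i. TImp (tmem (\<sigma>s ! i) (Var i) (shift m (Bs ! i)))) [0..<m] A))"

section \<open>The interpretation\<close>

text \<open>Types of the witnesses of an implication: for positive/negative types \<open>as\<close>/\<open>bs\<close> of the
  premise and \<open>cs\<close>/\<open>ds\<close> of the conclusion, the positive ones are those of the tuples \<open>f\<close>
  (from \<open>as\<close> to \<open>cs\<close>) and \<open>g\<close> (from \<open>as\<close> and \<open>ds\<close> to finite sets over \<open>bs\<close>), the negative
  ones are \<open>as @ ds\<close>.\<close>

definition arrs :: "ty list \<Rightarrow> ty \<Rightarrow> ty" where
  "arrs \<sigma>s \<tau> = foldr Arr \<sigma>s \<tau>"

definition pos_imp :: "ty list \<Rightarrow> ty list \<Rightarrow> ty list \<Rightarrow> ty list \<Rightarrow> ty list" where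
  "pos_imp as bs cs ds = map (arrs as) cs @ map (\<lambda>\<beta>. arrs (as @ ds) (Star \<beta>)) bs"

text \<open>Witness types of the predicates I (canonical upon bounding).  These predicates exist for
  star-free types only; the values at \<^term>\<open>Star\<close>, here and in \<open>interp_I\<close>, are irrelevant.\<close>

fun pos_I :: "ty \<Rightarrow> ty list" and neg_I :: "ty \<Rightarrow> ty list" where
  "pos_I tyN = [tyN]"
| "pos_I tyB = []"
| "pos_I (\<rho> \<rightarrow> \<sigma>) = pos_imp (pos_I \<rho>) (neg_I \<rho>) (pos_I \<sigma>) (neg_I \<sigma>)"
| "pos_I (Star \<sigma>) = []"
| "neg_I tyN = []"
| "neg_I tyB = []"
| "neg_I (\<rho> \<rightarrow> \<sigma>) = pos_I \<rho> @ neg_I \<sigma>"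
| "neg_I (Star \<sigma>) = []"

fun pos :: "ifm \<Rightarrow> ty list" and neg :: "ifm \<Rightarrow> ty list" where
  "pos IBot = []"
| "pos (IEq \<sigma> s t) = []"
| "pos (IPred \<sigma> t) = pos_I \<sigma>"
| "pos (IAnd A B) = pos A @ pos B"
| "pos (IImp A B) = pos_imp (pos A) (neg A) (pos B) (neg B)"
| "pos (IAll \<sigma> A) = pos A"
| "pos (IEx \<sigma> A) = pos A"
| "neg IBot = []"
| "neg (IEq \<sigma> s t) = []"
| "neg (IPred \<sigma> t) = neg_I \<sigma>"
| "neg (IAnd A B) = neg A @ neg B"
| "neg (IImp A B) = pos A @ neg B"
| "neg (IAll \<sigma> A) = neg A"
| "neg (IEx \<sigma> A) = map Star (neg A)"

text \<open>\<open>interp_I \<sigma> t as bs\<close> is the interpretation of \<open>I\<^sub>\<sigma>(t)\<close> with the tuples of terms \<open>as\<close> and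
  \<open>bs\<close> as positive and negative arguments.\<close>

fun interp_I :: "ty \<Rightarrow> tm \<Rightarrow> tm list \<Rightarrow> tm list \<Rightarrow> tfm" where
  "interp_I tyN t as bs = tle t (hd as)"
| "interp_I tyB t as bs = TImp TBot TBot"
| "interp_I (\<rho> \<rightarrow> \<sigma>) h fg ad =
    (let fs = take (length (pos_I \<sigma>)) fg; gs = drop (length (pos_I \<sigma>)) fg;
         as = take (length (pos_I \<rho>)) ad; ds = drop (length (pos_I \<rho>)) ad;
         m = length (neg_I \<rho>)
     in TAll \<rho> (TImp
          (tballs (neg_I \<rho>) (map (\<lambda>g. shift 1 (apps g (as @ ds))) gs)
            (interp_I \<rho> (Var m) (map (shift (Suc m)) as) (vars m)))
          (interp_I \<sigma> (shift 1 h \<bullet> Var 0)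
            (map (\<lambda>f. shift 1 (apps f as)) fs) (map (shift 1) ds))))"
| "interp_I (Star \<sigma>) t as bs = TBot"

lemma size_ishift [simp]: "size (ishift m A) = size A"
proof -
  have "size (iren r A) = size A" for r
    by (induction A arbitrary: r) auto
  then show ?thesis by (simp add: ishift_def)
qed

function interp :: "ifm \<Rightarrow> tm list \<Rightarrow> tm list \<Rightarrow> tfm" where
  "interp IBot as bs = TBot"
| "interp (IEq \<sigma> s t) as bs = TEq \<sigma> s t"
| "interp (IPred \<sigma> t) as bs = interp_I \<sigma> t as bs"
| "interp (IAnd A B) ac bd =
    TAnd (interp A (take (length (pos A)) ac) (take (length (neg A)) bd))
         (interp B (drop (length (pos A)) ac) (drop (length (neg A)) bd))"
| "interp (IImp A B) fg ad =
    (let fs = take (length (pos B)) fg; gs = drop (length (pos B)) fg;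
         as = take (length (pos A)) ad; ds = drop (length (pos A)) ad;
         m = length (neg A)
     in TImp
          (tballs (neg A) (map (\<lambda>g. apps g (as @ ds)) gs)
            (interp (ishift m A) (map (shift m) as) (vars m)))
          (interp B (map (\<lambda>f. apps f as) fs) ds))"
| "interp (IAll \<sigma> A) as bs = TAll \<sigma> (interp A (map (shift 1) as) (map (shift 1) bs))"
| "interp (IEx \<sigma> A) as Bs =
    (let m = length (neg A)
     in TEx \<sigma> (tballs (neg A) (map (shift 1) Bs)
          (interp (ishift m A) (map (shift (Suc m)) as) (vars m))))"
  by pat_completeness auto
termination by (relation "measure (\<lambda>(A, as, bs). size A)") auto

section \<open>The full type structure and its theory\<close>

text \<open>The full type structure over the naturals is too large to be built as a single type in HOL.
  It is therefore taken as given on some type \<open>'u\<close>: \<open>car M \<sigma>\<close> is the set of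
  objects of type \<open>\<sigma>\<close>, \<open>natv\<close> and \<open>boolv\<close> name those of ground type, \<open>app\<close> is
  application and \<open>els\<close> gives the finite set represented by an object of type \<^term>\<open>Star \<sigma>\<close>.
  Any two full structures are isomorphic, so the
  truth of a sentence does not depend on the choice of \<open>M\<close>.\<close>

record 'u type_structure =
  car :: "ty \<Rightarrow> 'u set"
  natv :: "nat \<Rightarrow> 'u"
  boolv :: "bool \<Rightarrow> 'u"
  app :: "'u \<Rightarrow> 'u \<Rightarrow> 'u"
  els :: "'u \<Rightarrow> 'u set"

definition full_structure :: "'u type_structure \<Rightarrow> bool" where
  "full_structure M \<longleftrightarrow>
     bij_betw (natv M) UNIV (car M tyN) \<and>
     bij_betw (boolv M) UNIV (car M tyB) \<and>
     (\<forall>\<rho> \<sigma>. bij_betw (\<lambda>h. restrict (app M h) (car M \<rho>))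
               (car M (\<rho> \<rightarrow> \<sigma>)) (car M \<rho> \<rightarrow>\<^sub>E car M \<sigma>)) \<and>
     (\<forall>\<sigma>. bij_betw (els M) (car M (Star \<sigma>)) {X. X \<noteq> {} \<and> finite X \<and> X \<subseteq> car M \<sigma>})"

definition natof :: "'u type_structure \<Rightarrow> 'u \<Rightarrow> nat" where
  "natof M v = (THE n. natv M n = v)"

text \<open>The object of type \<open>\<rho> \<rightarrow> \<sigma>\<close> representing the function \<open>F\<close>, and the object of type
  \<^term>\<open>Star \<sigma>\<close> representing the set \<open>X\<close>.\<close>

definition fn :: "'u type_structure \<Rightarrow> ty \<Rightarrow> ty \<Rightarrow> ('u \<Rightarrow> 'u) \<Rightarrow> 'u" where
  "fn M \<rho> \<sigma> F = (THE h. h \<in> car M (\<rho> \<rightarrow> \<sigma>) \<and> (\<forall>x\<in>car M \<rho>. app M h x = F x))"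

definition fset :: "'u type_structure \<Rightarrow> ty \<Rightarrow> 'u set \<Rightarrow> 'u" where
  "fset M \<sigma> X = (THE s. s \<in> car M (Star \<sigma>) \<and> els M s = X)"

primrec const_val :: "'u type_structure \<Rightarrow> const \<Rightarrow> 'u" where
  "const_val M (cK \<rho> \<sigma>) = fn M \<rho> (\<sigma> \<rightarrow> \<rho>) (\<lambda>x. fn M \<sigma> \<rho> (\<lambda>y. x))"
| "const_val M (cS \<rho> \<sigma> \<tau>) =
    fn M (\<rho> \<rightarrow> \<sigma> \<rightarrow> \<tau>) ((\<rho> \<rightarrow> \<sigma>) \<rightarrow> \<rho> \<rightarrow> \<tau>) (\<lambda>x. fn M (\<rho> \<rightarrow> \<sigma>) (\<rho> \<rightarrow> \<tau>) (\<lambda>y.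
      fn M \<rho> \<tau> (\<lambda>z. app M (app M x z) (app M y z))))"
| "const_val M cZero = natv M 0"
| "const_val M cSucc = fn M tyN tyN (\<lambda>x. natv M (Suc (natof M x)))"
| "const_val M (cRec \<sigma>) =
    fn M \<sigma> ((tyN \<rightarrow> \<sigma> \<rightarrow> \<sigma>) \<rightarrow> tyN \<rightarrow> \<sigma>) (\<lambda>x. fn M (tyN \<rightarrow> \<sigma> \<rightarrow> \<sigma>) (tyN \<rightarrow> \<sigma>) (\<lambda>y.
      fn M tyN \<sigma> (\<lambda>n. rec_nat x (\<lambda>k r. app M (app M y (natv M k)) r) (natof M n))))"
| "const_val M cTrue = boolv M True"
| "const_val M cFalse = boolv M False"
| "const_val M (cCond \<sigma>) =
    fn M tyB (\<sigma> \<rightarrow> \<sigma> \<rightarrow> \<sigma>) (\<lambda>b. fn M \<sigma> (\<sigma> \<rightarrow> \<sigma>) (\<lambda>x. fn M \<sigma> \<sigma> (\<lambda>y.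
      if b = boolv M True then x else y)))"
| "const_val M (cSing \<sigma>) = fn M \<sigma> (Star \<sigma>) (\<lambda>x. fset M \<sigma> {x})"
| "const_val M (cUnion \<sigma>) =
    fn M (Star \<sigma>) (Star \<sigma> \<rightarrow> Star \<sigma>) (\<lambda>x. fn M (Star \<sigma>) (Star \<sigma>) (\<lambda>y.
      fset M \<sigma> (els M x \<union> els M y)))"
| "const_val M (cIUnion \<rho> \<sigma>) =
    fn M (Star \<rho>) ((\<rho> \<rightarrow> Star \<sigma>) \<rightarrow> Star \<sigma>) (\<lambda>x. fn M (\<rho> \<rightarrow> Star \<sigma>) (Star \<sigma>) (\<lambda>f.
      fset M \<sigma> (\<Union>z\<in>els M x. els M (app M f z))))"
| "const_val M (cMem \<sigma>) =
    fn M \<sigma> (Star \<sigma> \<rightarrow> tyB) (\<lambda>x. fn M (Star \<sigma>) tyB (\<lambda>y. boolv M (x \<in> els M y)))"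
| "const_val M cMax = fn M (Star tyN) tyN (\<lambda>x. natv M (Max (natof M ` els M x)))"

primrec val :: "'u type_structure \<Rightarrow> (nat \<Rightarrow> 'u) \<Rightarrow> tm \<Rightarrow> 'u" where
  "val M e (Var i) = e i"
| "val M e (Con c) = const_val M c"
| "val M e (s \<bullet> t) = app M (val M e s) (val M e t)"

primrec sat :: "'u type_structure \<Rightarrow> (nat \<Rightarrow> 'u) \<Rightarrow> tfm \<Rightarrow> bool" where
  "sat M e TBot = False"
| "sat M e (TEq \<sigma> s t) = (val M e s = val M e t)"
| "sat M e (TAnd A B) = (sat M e A \<and> sat M e B)"
| "sat M e (TImp A B) = (sat M e A \<longrightarrow> sat M e B)"
| "sat M e (TAll \<sigma> A) = (\<forall>x\<in>car M \<sigma>. sat M (case_nat x e) A)"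
| "sat M e (TEx \<sigma> A) = (\<exists>x\<in>car M \<sigma>. sat M (case_nat x e) A)"

definition theory_of :: "'u type_structure \<Rightarrow> tfm set" where
  "theory_of M = {A. twf [] A \<and> (\<forall>e. sat M e A)}"

section \<open>Interpretability\<close>

text \<open>In both notions \<open>\<Gamma>\<close> lists the types of the free variables of \<open>A\<close>.  The target theory is
  complete and deductively closed, so it proves a formula iff the universal closure is a member.\<close>

definition U_interpretable :: "'u type_structure \<Rightarrow> ty list \<Rightarrow> ifm \<Rightarrow> bool" where
  "U_interpretable M \<Gamma> A \<longleftrightarrow>
     (\<exists>ts. list_all2 (\<lambda>t \<tau>. witnessing_ty \<tau> \<and> typed [] t \<tau>) ts (pos A) \<and>
           (let m = length (neg A)
            in talls \<Gamma> (talls (neg A) (interp (ishift m A) ts (vars m))) \<in> theory_of M))"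

primrec ialls :: "ty list \<Rightarrow> ifm \<Rightarrow> ifm" where
  "ialls [] A = A"
| "ialls (\<sigma> # \<sigma>s) A = ialls \<sigma>s (IAll \<sigma> A)"

fun iconj :: "ifm list \<Rightarrow> ifm" where
  "iconj [] = IImp IBot IBot"
| "iconj [A] = A"
| "iconj (A # B # As) = IAnd A (iconj (B # As))"

definition I_interpretable :: "'u type_structure \<Rightarrow> ty list \<Rightarrow> sfm \<Rightarrow> bool" where
  "I_interpretable M \<Gamma> A \<longleftrightarrow>
     U_interpretable M []
       (ialls \<Gamma> (IImp (iconj (map (\<lambda>i. IPred (\<Gamma> ! i) (Var i)) [0..<length \<Gamma>])) (rel A)))"

definition no_positive_I_witnesses :: "sfm \<Rightarrow> bool" where
  "no_positive_I_witnesses A \<longleftrightarrow> pos (rel A) = []"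

text \<open>The contra-collection principle for \<open>C(f, n)\<close>, where in \<open>C\<close> the variable \<open>n\<close> has index 0,
  \<open>f\<close> has index 1 and the parameters follow.  In the premise the additional quantifier over
  \<open>k\<close> shifts the parameters.\<close>

definition contra_collection :: "sfm \<Rightarrow> sfm" where
  "contra_collection C =
     SImp (SAll tyN (SExLe1 (SAllLe (Var 1) (sren (up (up Suc)) C))))
          (SExLe1 (SAll tyN C))"

end

theory Submission
  imports Defs
begin

text \<open>Since \<open>C\<close> has no positive witnesses, neither have the premise and the conclusion, and the
  conclusion is challenged by finite sets \<open>B\<close> (of arguments at which \<open>f \<le> 1\<close> is tested),
  \<open>N\<close> (of bounds on \<open>n\<close>) and \<open>D\<close> (of challenges to \<open>C\<close>).  Answer with the
  singletons of \<open>max N\<close>, \<open>B\<close> and \<open>D\<close> as challenges to the premise: it yields an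
  \<open>f\<close> that passes all tests in \<open>B\<close> and satisfies \<open>C(f,n)\<close> against \<open>D\<close> for all
  \<open>n \<le> max N\<close>, and this \<open>f\<close> works for the conclusion.  The positive witnesses of the
  parameters are ignored and their negative ones are arbitrary, because the interpreted principle
  holds for all values of the parameters.\<close>

text \<open>Otherwise every function type would parse ambiguously.\<close>

unbundle no funcset_syntax

section \<open>Well-typedness of the interpretation\<close>

lemma typed_App: "typed \<Gamma> s (\<rho> \<rightarrow> \<sigma>) \<Longrightarrow> typed \<Gamma> t \<rho> \<Longrightarrow> typed \<Gamma> (s \<bullet> t) \<sigma>"
  by (rule typed.intros)

text \<open>The type is a variable tied to \<open>const_ty c\<close> by an equation, so the rule
  applies to goals whose type is in any form; \<open>typed_Var\<close> does the same for the entries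
  of the context.\<close>

lemma typed_Con: "const_ty c = \<sigma> \<Longrightarrow> typed \<Gamma> (Con c) \<sigma>"
  using typed.intros(2) by blast

lemma typed_Var: "i < length \<Gamma> \<Longrightarrow> \<Gamma> ! i = \<sigma> \<Longrightarrow> typed \<Gamma> (Var i) \<sigma>"
  using typed.intros(1) by blast

section \<open>Renamings and shifts preserve typing\<close>

definition ren_ok :: "(nat \<Rightarrow> nat) \<Rightarrow> ty list \<Rightarrow> ty list \<Rightarrow> bool" where
  "ren_ok r \<Gamma> \<Delta> \<longleftrightarrow> (\<forall>i < length \<Gamma>. r i < length \<Delta> \<and> \<Delta> ! r i = \<Gamma> ! i)"

lemma ren_ok_up: "ren_ok r \<Gamma> \<Delta> \<Longrightarrow> ren_ok (up r) (\<sigma> # \<Gamma>) (\<sigma> # \<Delta>)"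
  unfolding ren_ok_def up_def by (auto split: nat.split)

lemma ren_ok_shift: "m = length \<Delta> \<Longrightarrow> ren_ok (\<lambda>i. i + m) \<Gamma> (\<Delta> @ \<Gamma>)"
  unfolding ren_ok_def by (simp add: nth_append)

lemma typed_ren: "typed \<Gamma> t \<sigma> \<Longrightarrow> ren_ok r \<Gamma> \<Delta> \<Longrightarrow> typed \<Delta> (ren r t) \<sigma>"
  by (induction rule: typed.induct) (auto simp: ren_ok_def intro: typed.intros typed_Var)

lemma typed_shift: "typed \<Gamma> t \<sigma> \<Longrightarrow> m = length \<Delta> \<Longrightarrow> typed (\<Delta> @ \<Gamma>) (shift m t) \<sigma>"
  unfolding shift_def by (blast intro: typed_ren ren_ok_shift)

lemma typed_shift1: "typed \<Gamma> t \<sigma> \<Longrightarrow> typed (\<rho> # \<Gamma>) (shift 1 t) \<sigma>"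
  using typed_shift[where \<Delta> = "[\<rho>]"] by simp

text \<open>This is the context met under one quantifier followed by a block of \<open>m\<close>
  bounded variables: the quantified variable lies behind the block, so a term from outside is
  shifted by \<open>Suc m\<close>.\<close>

lemma typed_shift_Suc:
  "typed \<Gamma> t \<sigma> \<Longrightarrow> m = length \<Delta> \<Longrightarrow> typed (\<Delta> @ \<rho> # \<Gamma>) (shift (Suc m) t) \<sigma>"
  using typed_shift[where \<Delta> = "\<Delta> @ [\<rho>]"] by simp

lemma arrs_append: "arrs (\<rho>s @ \<sigma>s) \<tau> = arrs \<rho>s (arrs \<sigma>s \<tau>)"
  by (simp add: arrs_def)

lemma arrs_Nil [simp]: "arrs [] \<tau> = \<tau>" and arrs_Cons [simp]: "arrs (\<sigma> # \<sigma>s) \<tau> = \<sigma> \<rightarrow> arrs \<sigma>s \<tau>"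
  by (simp_all add: arrs_def)

lemma typed_apps:
  "list_all2 (typed \<Gamma>) ts \<sigma>s \<Longrightarrow> typed \<Gamma> f (arrs \<sigma>s \<tau>) \<Longrightarrow> typed \<Gamma> (apps f ts) \<tau>"
proof (induction ts \<sigma>s arbitrary: f rule: list_all2_induct)
  case Nil
  then show ?case by (simp add: apps_def)
next
  case (Cons t ts \<sigma> \<sigma>s)
  then have "typed \<Gamma> (f \<bullet> t) (arrs \<sigma>s \<tau>)" by (auto intro: typed_App)
  from Cons.IH[OF this] show ?case by (simp add: apps_def)
qed

lemma typed_vars: "m = length \<Delta> \<Longrightarrow> list_all2 (typed (\<Delta> @ \<Gamma>)) (vars m) \<Delta>"
  by (auto simp: vars_def list_all2_conv_all_nth nth_append intro!: typed_Var)

lemma typed_monus: "typed \<Gamma> s tyN \<Longrightarrow> typed \<Gamma> t tyN \<Longrightarrow> typed \<Gamma> (monus s t) tyN"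
  unfolding monus_def pred_tm_def
  by (rule typed_App typed_Con | assumption | simp)+

lemma typed_one_tm: "typed \<Gamma> one_tm tyN"
  unfolding one_tm_def by (rule typed_App typed_Con | simp)+

section \<open>Well-formedness of quantifier blocks and of the interpretation of the predicates
  I\<close>

lemma twf_talls: "twf \<Gamma> (talls \<sigma>s A) = twf (\<sigma>s @ \<Gamma>) A"
  by (induction \<sigma>s arbitrary: A) auto

lemma twf_foldr_TImp:
  "(\<And>i. i \<in> set is \<Longrightarrow> twf \<Gamma> (F i)) \<Longrightarrow> twf \<Gamma> A \<Longrightarrow> twf \<Gamma> (foldr (\<lambda>i. TImp (F i)) is A)"
  by (induction "is") auto

lemma twf_tmem: "typed \<Gamma> s \<sigma> \<Longrightarrow> typed \<Gamma> t (Star \<sigma>) \<Longrightarrow> twf \<Gamma> (tmem \<sigma> s t)"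
  unfolding tmem_def by (auto intro!: typed_App typed_Con)

lemma twf_tballs:
  assumes "list_all2 (typed \<Gamma>) Bs (map Star \<sigma>s)" "twf (\<sigma>s @ \<Gamma>) A"
  shows "twf \<Gamma> (tballs \<sigma>s Bs A)"
  using assms unfolding tballs_def Let_def twf_talls
  by (intro twf_foldr_TImp twf_tmem typed_shift)
    (auto simp: list_all2_conv_all_nth nth_append intro!: typed_Var)

lemma list_all2_map_typed:
  assumes "list_all2 (typed \<Gamma>) ts \<sigma>s" "\<And>t \<sigma>. typed \<Gamma> t \<sigma> \<Longrightarrow> typed \<Delta> (f t) \<sigma>"
  shows "list_all2 (typed \<Delta>) (map f ts) \<sigma>s"
  using assms by (auto simp: list_all2_conv_all_nth)

lemma list_all2_apps:
  assumes "list_all2 (typed \<Gamma>) fs (map (\<lambda>\<beta>. arrs \<sigma>s (F \<beta>)) \<beta>s)" "list_all2 (typed \<Gamma>) ts \<sigma>s"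
  shows "list_all2 (typed \<Gamma>) (map (\<lambda>f. apps f ts) fs) (map F \<beta>s)"
  using assms by (auto simp: list_all2_conv_all_nth[of _ fs] list_all2_conv_all_nth[of _ "map _ fs"] intro: typed_apps)

lemma list_all2_split:
  assumes "list_all2 R xs (as @ bs)"
  shows "list_all2 R (take (length as) xs) as" "list_all2 R (drop (length as) xs) bs"
  using assms by (auto simp: list_all2_append2)

text \<open>Separates the witnesses of an implication into the tuple that answers for the conclusion
  and the tuple that computes finite sets of challenges to the premise.\<close>

lemma pos_imp_split:
  assumes "list_all2 R fg (pos_imp as bs cs ds)"
  shows "list_all2 R (take (length cs) fg) (map (arrs as) cs)"
    and "list_all2 R (drop (length cs) fg) (map (\<lambda>\<beta>. arrs (as @ ds) (Star \<beta>)) bs)"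
  using assms list_all2_split[of R fg "map (arrs as) cs"] unfolding pos_imp_def by auto

lemma twf_interp_I:
  assumes "typed \<Gamma> t \<sigma>" "list_all2 (typed \<Gamma>) as (pos_I \<sigma>)" "list_all2 (typed \<Gamma>) bs (neg_I \<sigma>)"
  shows "twf \<Gamma> (interp_I \<sigma> t as bs)"
  using assms
proof (induction \<sigma> t as bs arbitrary: \<Gamma> rule: interp_I.induct)
  case (1 t as bs)
  then show ?case by (auto simp: tle_def list_all2_Cons2 intro: typed_monus typed_Con)
next
  case (3 \<rho> \<sigma> h fg ad)
  define fs where "fs = take (length (pos_I \<sigma>)) fg"
  define gs where "gs = drop (length (pos_I \<sigma>)) fg"
  define as where "as = take (length (pos_I \<rho>)) ad"
  define ds where "ds = drop (length (pos_I \<rho>)) ad"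
  have ty: "list_all2 (typed \<Gamma>) fs (map (arrs (pos_I \<rho>)) (pos_I \<sigma>))"
     "list_all2 (typed \<Gamma>) gs (map (\<lambda>\<beta>. arrs (pos_I \<rho> @ neg_I \<sigma>) (Star \<beta>)) (neg_I \<rho>))"
     "list_all2 (typed \<Gamma>) as (pos_I \<rho>)" "list_all2 (typed \<Gamma>) ds (neg_I \<sigma>)"
    using pos_imp_split[OF 3(4)[simplified]] list_all2_split[OF 3(5)[simplified]]
    unfolding fs_def gs_def as_def ds_def by auto
  have "list_all2 (typed (\<rho> # \<Gamma>)) (map (\<lambda>g. shift 1 (apps g (as @ ds))) gs) (map Star (neg_I \<rho>))"
    using list_all2_map_typed[OF list_all2_apps[OF ty(2) list_all2_appendI[OF ty(3,4)]] typed_shift1]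
    by (simp add: comp_def)
  moreover have "twf (neg_I \<rho> @ \<rho> # \<Gamma>) (interp_I \<rho> (Var (length (neg_I \<rho>)))
     (map (shift (Suc (length (neg_I \<rho>)))) as) (vars (length (neg_I \<rho>))))"
    unfolding as_def
    \<comment> \<open>The local definitions of \<open>interp_I\<close> enter its induction
      hypotheses as equations; the \<open>refl\<close>s instantiate them.\<close>
    by (rule 3(1)[OF refl refl refl refl refl])
      (auto simp: nth_append intro!: typed_Var typed_vars list_all2_map_typed[OF ty(3)[unfolded as_def]] typed_shift_Suc)
  moreover have "list_all2 (typed (\<rho> # \<Gamma>)) (map (\<lambda>f. shift 1 (apps f as)) fs) (pos_I \<sigma>)"
    using list_all2_map_typed[OF list_all2_apps[OF ty(1) ty(3)] typed_shift1]
    by (simp add: comp_def)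
  then have "twf (\<rho> # \<Gamma>) (interp_I \<sigma> (shift 1 h \<bullet> Var 0)
     (map (\<lambda>f. shift 1 (apps f as)) fs) (map (shift 1) ds))"
    unfolding fs_def as_def ds_def
    by (intro 3(2)[OF refl refl refl refl refl])
      (auto intro!: typed_App[OF typed_shift1[OF 3(3), simplified]] typed_Var
        list_all2_map_typed[OF ty(4)[unfolded ds_def]] typed_shift1[simplified])
  ultimately show ?case
    by (simp add: Let_def twf_tballs flip: fs_def gs_def as_def ds_def)
qed auto

section \<open>Well-formed formulas with the predicates I, and their interpretations\<close>

primrec iwf :: "ty list \<Rightarrow> ifm \<Rightarrow> bool" where
  "iwf \<Gamma> IBot = True"
| "iwf \<Gamma> (IEq \<sigma> s t) = (typed \<Gamma> s \<sigma> \<and> typed \<Gamma> t \<sigma>)"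
| "iwf \<Gamma> (IPred \<sigma> t) = typed \<Gamma> t \<sigma>"
| "iwf \<Gamma> (IAnd A B) = (iwf \<Gamma> A \<and> iwf \<Gamma> B)"
| "iwf \<Gamma> (IImp A B) = (iwf \<Gamma> A \<and> iwf \<Gamma> B)"
| "iwf \<Gamma> (IAll \<sigma> A) = iwf (\<sigma> # \<Gamma>) A"
| "iwf \<Gamma> (IEx \<sigma> A) = iwf (\<sigma> # \<Gamma>) A"

lemma iwf_iren: "iwf \<Gamma> A \<Longrightarrow> ren_ok r \<Gamma> \<Delta> \<Longrightarrow> iwf \<Delta> (iren r A)"
  by (induction A arbitrary: r \<Gamma> \<Delta>) (auto intro: typed_ren ren_ok_up)

lemma iwf_ishift: "iwf \<Gamma> A \<Longrightarrow> m = length \<Delta> \<Longrightarrow> iwf (\<Delta> @ \<Gamma>) (ishift m A)"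
  unfolding ishift_def by (blast intro: iwf_iren ren_ok_shift)

text \<open>Witness types are read off from the connectives and the types in a formula, never from
  its terms.\<close>

lemma pos_iren [simp]: "pos (iren r A) = pos A" and neg_iren [simp]: "neg (iren r A) = neg A"
  by (induction A arbitrary: r) auto

lemma pos_ishift [simp]: "pos (ishift m A) = pos A" and neg_ishift [simp]: "neg (ishift m A) = neg A"
  by (simp_all add: ishift_def)

lemma twf_interp:
  assumes "iwf \<Gamma> A" "list_all2 (typed \<Gamma>) as (pos A)" "list_all2 (typed \<Gamma>) bs (neg A)"
  shows "twf \<Gamma> (interp A as bs)"
  using assms
proof (induction A as bs arbitrary: \<Gamma> rule: interp.induct)
  case (3 \<sigma> t as bs)
  then show ?case by (simp add: twf_interp_I)
next
  case (4 A B ac bd)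
  then show ?case using list_all2_split[of "typed \<Gamma>" ac "pos A" "pos B"]
    list_all2_split[of "typed \<Gamma>" bd "neg A" "neg B"] by auto
next
  case (5 A B fg ad)
  define fs where "fs = take (length (pos B)) fg"
  define gs where "gs = drop (length (pos B)) fg"
  define as where "as = take (length (pos A)) ad"
  define ds where "ds = drop (length (pos A)) ad"
  have ty: "list_all2 (typed \<Gamma>) fs (map (arrs (pos A)) (pos B))"
     "list_all2 (typed \<Gamma>) gs (map (\<lambda>\<beta>. arrs (pos A @ neg B) (Star \<beta>)) (neg A))"
     "list_all2 (typed \<Gamma>) as (pos A)" "list_all2 (typed \<Gamma>) ds (neg B)"
    using pos_imp_split[OF 5(4)[simplified]] list_all2_split[OF 5(5)[simplified]]
    unfolding fs_def gs_def as_def ds_def by auto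
  have "list_all2 (typed \<Gamma>) (map (\<lambda>g. apps g (as @ ds)) gs) (map Star (neg A))"
    using list_all2_apps[OF ty(2) list_all2_appendI[OF ty(3,4)]] by simp
  moreover have "twf (neg A @ \<Gamma>) (interp (ishift (length (neg A)) A)
     (map (shift (length (neg A))) as) (vars (length (neg A))))"
    unfolding as_def
    by (rule 5(1)[OF refl refl refl refl refl]) (use 5(3) in
      \<open>auto intro!: iwf_ishift typed_vars list_all2_map_typed[OF ty(3)[unfolded as_def]] typed_shift\<close>)
  moreover have "twf \<Gamma> (interp B (map (\<lambda>f. apps f as) fs) ds)"
    using list_all2_apps[OF ty(1) ty(3)] 5(3) ty(4)
    unfolding fs_def as_def ds_def
    by (intro 5(2)[OF refl refl refl refl refl]) auto
  ultimately show ?case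
    by (simp add: Let_def twf_tballs flip: fs_def gs_def as_def ds_def)
next
  case (6 \<sigma> A as bs)
  then show ?case by (auto intro!: 6(1) list_all2_map_typed typed_shift1[simplified])
next
  \<comment> \<open>A challenge to an existential statement consists of finite sets, which serve as
    bounds of the inner block; hence the \<open>Star\<close> types of \<open>Bs\<close>.\<close>
  case (7 \<sigma> A as Bs)
  have "twf (neg A @ \<sigma> # \<Gamma>) (interp (ishift (length (neg A)) A)
     (map (shift (Suc (length (neg A)))) as) (vars (length (neg A))))"
    by (rule 7(1)[OF refl]) (use 7 in
      \<open>auto intro!: iwf_ishift typed_vars list_all2_map_typed typed_shift_Suc\<close>)
  moreover have "list_all2 (typed (\<sigma> # \<Gamma>)) (map (shift 1) Bs) (map Star (neg A))"
    using 7 by (auto intro!: list_all2_map_typed typed_shift1[simplified])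
  ultimately show ?case by (simp add: Let_def twf_tballs)
qed auto

lemma iwf_rel: "swf \<Gamma> A \<Longrightarrow> iwf \<Gamma> (rel A)"
proof (induction A arbitrary: \<Gamma>)
  case (SAllLe t A)
  then show ?case
    by (auto simp: ile_def intro!: typed_monus typed_Var typed_Con typed_shift1[simplified])
next
  case (SExLe t A)
  then show ?case
    by (auto simp: ile_def intro!: typed_monus typed_Var typed_Con typed_shift1[simplified])
\<comment> \<open>Fixing the argument type of \<open>typed_App\<close> to \<open>tyN\<close> settles
  the type of \<open>n\<close> in the application of \<open>f\<close> to \<open>n\<close> inside
  \<open>ile1\<close>.\<close>
qed (auto simp: ile_def ile1_def intro!: typed_monus typed_App[of _ _ tyN] typed_Var typed_Con typed_one_tm)

lemma ren_shift1: "ren (up r) (shift 1 t) = shift 1 (ren r t)"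
  unfolding shift_def by (induction t) (auto simp: up_def)

lemma iren_ile: "iren r (ile s t) = ile (ren r s) (ren r t)"
  by (simp add: ile_def monus_def pred_tm_def)

lemma iren_ile1: "iren (up r) ile1 = ile1"
  by (simp add: ile1_def iren_ile up_def one_tm_def)

lemma up_0 [simp]: "up r 0 = 0"
  by (simp add: up_def)

text \<open>Needed because the premise of the principle contains a renamed copy of \<open>C\<close>:
  its relativization is thereby a renaming of that of \<open>C\<close> itself.\<close>

lemma rel_sren: "rel (sren r A) = iren r (rel A)"
  by (induction A arbitrary: r)
    (auto simp: iren_ile iren_ile1 ren_shift1[simplified] up_0)


lemma witnessing_arrs [simp]:
  "witnessing_ty (arrs \<sigma>s \<tau>) \<longleftrightarrow> (\<forall>\<sigma>\<in>set \<sigma>s. witnessing_ty \<sigma>) \<and> witnessing_ty \<tau>"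
  by (induction \<sigma>s) auto

text \<open>The Boolean predicate contributes no witnesses, so all witness types arise from
  \<open>tyN\<close> by arrows and \<open>Star\<close>.\<close>

lemma witnessing_pos_neg_I:
  "(\<forall>\<tau>\<in>set (pos_I \<sigma>). witnessing_ty \<tau>) \<and> (\<forall>\<tau>\<in>set (neg_I \<sigma>). witnessing_ty \<tau>)"
  by (induction \<sigma>) (auto simp: pos_imp_def)

lemma witnessing_pos_neg:
  "(\<forall>\<tau>\<in>set (pos A). witnessing_ty \<tau>) \<and> (\<forall>\<tau>\<in>set (neg A). witnessing_ty \<tau>)"
  by (induction A) (auto simp: pos_imp_def witnessing_pos_neg_I)

section \<open>Semantic counterpart of the interpretation\<close>

text \<open>An iterated \<open>case_nat\<close>: the values \<open>xs\<close> of a whole block of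
  innermost variables are put in front of \<open>e\<close>. Shifting by the length of the block
  skips them.\<close>

definition env :: "'u list \<Rightarrow> (nat \<Rightarrow> 'u) \<Rightarrow> nat \<Rightarrow> 'u" where
  "env xs e i = (if i < length xs then xs ! i else e (i - length xs))"

abbreviation in_car :: "'u type_structure \<Rightarrow> 'u list \<Rightarrow> ty list \<Rightarrow> bool" where
  "in_car M \<equiv> list_all2 (\<lambda>x \<sigma>. x \<in> car M \<sigma>)"

abbreviation appl :: "'u type_structure \<Rightarrow> 'u \<Rightarrow> 'u list \<Rightarrow> 'u" where
  "appl M \<equiv> foldl (app M)"

lemma env_Nil [simp]: "env [] e = e"
  by (auto simp: env_def)

lemma case_nat_env: "case_nat x (env xs e) = env (x # xs) e"
  by (auto simp: env_def fun_eq_iff split: nat.split)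

lemma env_shift: "m = length xs \<Longrightarrow> env xs e \<circ> (\<lambda>i. i + m) = e"
  by (auto simp: env_def)

lemma env_shift_Suc: "m = length xs \<Longrightarrow> env xs (case_nat x e) \<circ> (\<lambda>i. i + Suc m) = e"
  by (auto simp: env_def)

lemma case_nat_up: "case_nat x e \<circ> up r = case_nat x (e \<circ> r)"
  by (auto simp: up_def fun_eq_iff split: nat.split)

lemma sat_talls: "sat M e (talls \<sigma>s A) \<longleftrightarrow> (\<forall>xs. in_car M xs \<sigma>s \<longrightarrow> sat M (env xs e) A)"
  by (induction \<sigma>s arbitrary: A) (auto simp: case_nat_env list_all2_Cons2)

lemma val_ren: "val M e (ren r t) = val M (e \<circ> r) t"
  by (induction t) auto

lemma val_shift: "m = length xs \<Longrightarrow> val M (env xs e) (shift m t) = val M e t"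
  by (simp add: shift_def val_ren env_shift)

lemma val_shift1: "val M (case_nat x e) (shift 1 t) = val M e t"
  by (simp add: shift_def val_ren comp_def)

lemma val_shift_Suc:
  "m = length xs \<Longrightarrow> val M (env xs (case_nat x e)) (shift (Suc m) t) = val M e t"
  unfolding shift_def val_ren by (simp only: env_shift_Suc)

lemma val_apps: "val M e (apps t ts) = appl M (val M e t) (map (val M e) ts)"
  unfolding apps_def by (induction ts arbitrary: t) auto

lemma val_vars: "m = length xs \<Longrightarrow> map (val M (env xs e)) (vars m) = xs"
  by (auto simp: vars_def env_def intro: nth_equalityI)

definition memb :: "'u type_structure \<Rightarrow> ty \<Rightarrow> 'u \<Rightarrow> 'u \<Rightarrow> bool" where
  "memb M \<sigma> x B \<longleftrightarrow> app M (app M (const_val M (cMem \<sigma>)) x) B = boolv M True"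

text \<open>The order is read through the value of the truncated difference, with \<open>x\<close>
  and \<open>y\<close> assigned to the variables 0 and 1. That it is the usual order on numbers is
  proved for full structures in \<open>lev_natv\<close>.\<close>

definition lev :: "'u type_structure \<Rightarrow> 'u \<Rightarrow> 'u \<Rightarrow> bool" where
  "lev M x y \<longleftrightarrow> val M (case_nat x (\<lambda>_. y)) (monus (Var 0) (Var 1)) = natv M 0"

lemma val_monus_eq: "val M e (monus s t) = natv M 0 \<longleftrightarrow> lev M (val M e s) (val M e t)"
  by (simp add: lev_def monus_def pred_tm_def)

definition tb :: "'u type_structure \<Rightarrow> ty list \<Rightarrow> 'u list \<Rightarrow> ('u list \<Rightarrow> bool) \<Rightarrow> bool" where
  "tb M \<sigma>s Bs P \<longleftrightarrow>
     (\<forall>xs. in_car M xs \<sigma>s \<longrightarrow> (\<forall>i < length \<sigma>s. memb M (\<sigma>s ! i) (xs ! i) (Bs ! i)) \<longrightarrow> P xs)"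

lemma tb_Nil [simp]: "tb M [] Bs P \<longleftrightarrow> P []"
  by (simp add: tb_def)

text \<open>The bodies need to agree only on tuples of the right length; as a congruence rule this
  supplies the length condition under which the statements about \<open>interp\<close> can rewrite
  the body.\<close>

lemma tb_cong:
  assumes "\<sigma>s = \<tau>s" "Bs = Cs" "\<And>xs. length xs = length \<tau>s \<Longrightarrow> P xs = Q xs"
  shows "tb M \<sigma>s Bs P = tb M \<tau>s Cs Q"
  using assms
  unfolding tb_def by (auto dest: list_all2_lengthD)

lemma sat_foldr_TImp:
  "sat M e (foldr (\<lambda>i. TImp (F i)) is A) \<longleftrightarrow> ((\<forall>i\<in>set is. sat M e (F i)) \<longrightarrow> sat M e A)"
  by (induction "is") auto

lemma sat_tballs:
  assumes "length Bs = length \<sigma>s"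
  shows "sat M e (tballs \<sigma>s Bs A) \<longleftrightarrow>
    tb M \<sigma>s (map (val M e) Bs) (\<lambda>xs. sat M (env xs e) A)"
proof -
  have "(\<forall>i\<in>set [0..<length \<sigma>s].
        sat M (env xs e) (tmem (\<sigma>s ! i) (Var i) (shift (length \<sigma>s) (Bs ! i))))
      \<longleftrightarrow> (\<forall>i<length \<sigma>s. memb M (\<sigma>s ! i) (xs ! i) (map (val M e) Bs ! i))"
    if "in_car M xs \<sigma>s" for xs
    using that[THEN list_all2_lengthD] assms
    by (auto simp: tmem_def memb_def val_shift) (auto simp: env_def)
  then show ?thesis
    unfolding tballs_def Let_def sat_talls sat_foldr_TImp tb_def by blast
qed

text \<open>Witness tuples are tuples of values here, so nothing is shifted under quantifiers, and
  the bounded block becomes a quantification over lists via \<open>tb\<close>.\<close>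

primrec isem_I :: "'u type_structure \<Rightarrow> ty \<Rightarrow> 'u \<Rightarrow> 'u list \<Rightarrow> 'u list \<Rightarrow> bool" where
  "isem_I M tyN x as bs = lev M x (hd as)"
| "isem_I M tyB x as bs = True"
| "isem_I M (\<rho> \<rightarrow> \<sigma>) h fg ad =
    (\<forall>x\<in>car M \<rho>.
       tb M (neg_I \<rho>) (map (\<lambda>g. appl M g ad) (drop (length (pos_I \<sigma>)) fg))
         (isem_I M \<rho> x (take (length (pos_I \<rho>)) ad)) \<longrightarrow>
       isem_I M \<sigma> (app M h x)
         (map (\<lambda>f. appl M f (take (length (pos_I \<rho>)) ad)) (take (length (pos_I \<sigma>)) fg))
         (drop (length (pos_I \<rho>)) ad))"
| "isem_I M (Star \<sigma>) x as bs = False"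

primrec isem :: "'u type_structure \<Rightarrow> ifm \<Rightarrow> (nat \<Rightarrow> 'u) \<Rightarrow> 'u list \<Rightarrow> 'u list \<Rightarrow> bool" where
  "isem M IBot e as bs = False"
| "isem M (IEq \<sigma> s t) e as bs = (val M e s = val M e t)"
| "isem M (IPred \<sigma> t) e as bs = isem_I M \<sigma> (val M e t) as bs"
| "isem M (IAnd A B) e ac bd =
    (isem M A e (take (length (pos A)) ac) (take (length (neg A)) bd) \<and>
     isem M B e (drop (length (pos A)) ac) (drop (length (neg A)) bd))"
| "isem M (IImp A B) e fg ad =
    (tb M (neg A) (map (\<lambda>g. appl M g ad) (drop (length (pos B)) fg))
       (isem M A e (take (length (pos A)) ad)) \<longrightarrow>
     isem M B e (map (\<lambda>f. appl M f (take (length (pos A)) ad)) (take (length (pos B)) fg))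
       (drop (length (pos A)) ad))"
| "isem M (IAll \<sigma> A) e as bs = (\<forall>x\<in>car M \<sigma>. isem M A (case_nat x e) as bs)"
| "isem M (IEx \<sigma> A) e as Bs = (\<exists>x\<in>car M \<sigma>. tb M (neg A) Bs (isem M A (case_nat x e) as))"

text \<open>A renaming is absorbed by the environment, since \<open>case_nat\<close> carries
  \<open>up r\<close> to \<open>r\<close> under a binder.\<close>

lemma isem_iren: "isem M (iren r A) e as bs = isem M A (e \<circ> r) as bs"
  by (induction A arbitrary: r e as bs) (simp_all add: val_ren case_nat_up cong: tb_cong)

lemma isem_ishift: "m = length xs \<Longrightarrow> isem M (ishift m A) (env xs e) as bs = isem M A e as bs"
  by (simp add: ishift_def isem_iren env_shift)

lemma length_pos_imp: "length (pos_imp as bs cs ds) = length cs + length bs"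
  by (simp add: pos_imp_def)

lemma sat_interp_I:
  assumes "length as = length (pos_I \<sigma>)" "length bs = length (neg_I \<sigma>)"
  shows "sat M e (interp_I \<sigma> t as bs) \<longleftrightarrow>
    isem_I M \<sigma> (val M e t) (map (val M e) as) (map (val M e) bs)"
  using assms
proof (induction \<sigma> t as bs arbitrary: e rule: interp_I.induct)
  case (1 t as bs)
  then show ?case by (cases as) (auto simp: tle_def val_monus_eq)
next
  case (3 \<rho> \<sigma> h fg ad)
  let ?as = "take (length (pos_I \<rho>)) ad"
  let ?m = "length (neg_I \<rho>)"
  have prem: "sat M (env xs (case_nat x e))
      (interp_I \<rho> (Var ?m) (map (shift (Suc ?m)) ?as) (vars ?m)) \<longleftrightarrow>
     isem_I M \<rho> x (take (length (pos_I \<rho>)) (map (val M e) ad)) xs"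
    if "length xs = ?m" for x xs
    using 3 that
    by (subst 3(1)[OF refl refl refl refl refl])
      (auto simp: vars_def length_pos_imp comp_def val_shift_Suc take_map env_def nth_equalityI
        intro!: arg_cong[where f = "isem_I M \<rho> x _"] nth_equalityI)
  have concl: "sat M (case_nat x e) (interp_I \<sigma> (shift 1 h \<bullet> Var 0)
      (map (\<lambda>f. shift 1 (apps f ?as)) (take (length (pos_I \<sigma>)) fg))
      (map (shift 1) (drop (length (pos_I \<rho>)) ad))) \<longleftrightarrow>
    isem_I M \<sigma> (app M (val M e h) x)
      (map (\<lambda>f. appl M f (take (length (pos_I \<rho>)) (map (val M e) ad)))
        (take (length (pos_I \<sigma>)) (map (val M e) fg)))
      (drop (length (pos_I \<rho>)) (map (val M e) ad))" for x
    using 3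
    by (subst 3(2)[OF refl refl refl refl refl])
      (auto simp: length_pos_imp comp_def val_shift1[simplified] val_apps take_map drop_map)
  show ?case
    using 3(3,4)
    by (simp add: Let_def sat_tballs length_pos_imp concl[simplified] prem comp_def val_shift1[simplified]
        val_apps take_map drop_map cong: tb_cong)
qed auto

text \<open>Transfers questions of truth from the syntactic interpretation to \<open>isem\<close>.
  The length conditions ensure that \<open>take\<close> and \<open>drop\<close> cut the tuples at
  the same places on both sides.\<close>

lemma sat_interp:
  assumes "length as = length (pos A)" "length bs = length (neg A)"
  shows "sat M e (interp A as bs) \<longleftrightarrow> isem M A e (map (val M e) as) (map (val M e) bs)"
  using assms
proof (induction A as bs arbitrary: e rule: interp.induct)
  case (3 \<sigma> t as bs)
  then show ?case by (simp add: sat_interp_I)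
next
  case (4 A B ac bd)
  then show ?case by (simp add: take_map drop_map)
next
  case (5 A B fg ad)
  let ?as = "take (length (pos A)) ad"
  let ?m = "length (neg A)"
  have "sat M (env xs e) (interp (ishift ?m A) (map (shift ?m) ?as) (vars ?m)) \<longleftrightarrow>
      isem M A e (take (length (pos A)) (map (val M e) ad)) xs" if "length xs = ?m" for xs
    using 5(3,4) that
    by (subst 5(1)[OF refl refl refl refl refl])
      (auto simp: isem_ishift val_vars comp_def val_shift take_map, auto simp: vars_def)
  moreover have "sat M e (interp B (map (\<lambda>f. apps f ?as) (take (length (pos B)) fg))
        (drop (length (pos A)) ad)) \<longleftrightarrow>
      isem M B e (map (\<lambda>f. appl M f (take (length (pos A)) (map (val M e) ad)))
        (take (length (pos B)) (map (val M e) fg))) (drop (length (pos A)) (map (val M e) ad))"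
    using 5(3,4)
    by (subst 5(2)[OF refl refl refl refl refl])
      (auto simp: length_pos_imp comp_def val_apps take_map drop_map)
  ultimately show ?case
    using 5(3,4)
    by (simp add: Let_def sat_tballs length_pos_imp comp_def val_apps take_map drop_map cong: tb_cong)
next
  case (6 \<sigma> A as bs)
  then show ?case by (simp add: comp_def val_shift1[simplified])
next
  case (7 \<sigma> A as Bs)
  let ?m = "length (neg A)"
  have "sat M (env xs (case_nat x e)) (interp (ishift ?m A) (map (shift (Suc ?m)) as) (vars ?m)) \<longleftrightarrow>
      isem M A (case_nat x e) (map (val M e) as) xs" if "length xs = ?m" for x xs
    using 7(2,3) that
    by (subst 7(1)[OF refl])
      (auto simp: isem_ishift val_vars comp_def val_shift_Suc, auto simp: vars_def)
  then show ?case
    using 7(2,3)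
    by (simp add: Let_def sat_tballs comp_def val_shift1[simplified] cong: tb_cong)
qed auto

section \<open>Full structures\<close>

context
  fixes M :: "'u type_structure"
  assumes full: "full_structure M"
begin

lemma natv_car [simp]: "natv M n \<in> car M tyN"
  using full unfolding full_structure_def by (auto simp: bij_betw_def)

lemma boolv_car [simp]: "boolv M b \<in> car M tyB"
  using full unfolding full_structure_def by (auto simp: bij_betw_def)

lemma natv_eq_iff [simp]: "natv M n = natv M k \<longleftrightarrow> n = k"
  using full unfolding full_structure_def by (auto simp: bij_betw_def inj_def)

lemma boolv_eq_iff [simp]: "boolv M b = boolv M c \<longleftrightarrow> b = c"
  using full unfolding full_structure_def by (auto simp: bij_betw_def inj_def)

lemma car_natE:
  assumes "x \<in> car M tyN" obtains n where "x = natv M n"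
  using assms full unfolding full_structure_def by (metis bij_betw_imp_surj_on rangeE)

lemma natof_natv [simp]: "natof M (natv M n) = n"
  by (simp add: natof_def)

lemma bij_arr:
  "bij_betw (\<lambda>h. restrict (app M h) (car M \<rho>)) (car M (\<rho> \<rightarrow> \<sigma>)) (car M \<rho> \<rightarrow>\<^sub>E car M \<sigma>)"
  using full unfolding full_structure_def by blast

lemma bij_els: "bij_betw (els M) (car M (Star \<sigma>)) {X. X \<noteq> {} \<and> finite X \<and> X \<subseteq> car M \<sigma>}"
  using full unfolding full_structure_def by blast

lemma app_car:
  assumes "h \<in> car M (\<rho> \<rightarrow> \<sigma>)" "x \<in> car M \<rho>"
  shows "app M h x \<in> car M \<sigma>"
proof -
  have "restrict (app M h) (car M \<rho>) \<in> car M \<rho> \<rightarrow>\<^sub>E car M \<sigma>"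
    using bij_arr assms(1) by (rule bij_betwE[THEN bspec])
  then show ?thesis using assms(2) by (metis PiE_mem restrict_apply)
qed

text \<open>Fullness enters here: surjectivity of the map from objects to functions gives a
  representing object, and injectivity, that is extensionality, makes the description in
  \<open>fn\<close> definite.\<close>

lemma fn_props:
  assumes "\<And>x. x \<in> car M \<rho> \<Longrightarrow> F x \<in> car M \<sigma>"
  shows "fn M \<rho> \<sigma> F \<in> car M (\<rho> \<rightarrow> \<sigma>) \<and> (\<forall>x\<in>car M \<rho>. app M (fn M \<rho> \<sigma> F) x = F x)"
  unfolding fn_def
proof (rule theI', rule ex_ex1I)
  have "restrict F (car M \<rho>) \<in> car M \<rho> \<rightarrow>\<^sub>E car M \<sigma>" using assms by auto
  then obtain h where "h \<in> car M (\<rho> \<rightarrow> \<sigma>)" "restrict (app M h) (car M \<rho>) = restrict F (car M \<rho>)"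
    using bij_betw_imp_surj_on[OF bij_arr] by (metis (no_types, lifting) imageE)
  then show "\<exists>h. h \<in> car M (\<rho> \<rightarrow> \<sigma>) \<and> (\<forall>x\<in>car M \<rho>. app M h x = F x)"
    by (metis restrict_apply')
next
  fix h k
  assume "h \<in> car M (\<rho> \<rightarrow> \<sigma>) \<and> (\<forall>x\<in>car M \<rho>. app M h x = F x)"
    and "k \<in> car M (\<rho> \<rightarrow> \<sigma>) \<and> (\<forall>x\<in>car M \<rho>. app M k x = F x)"
  then show "h = k"
    by (intro inj_onD[OF bij_betw_imp_inj_on[OF bij_arr]]) (auto simp: restrict_def fun_eq_iff)
qed

lemma fn_car: "(\<And>x. x \<in> car M \<rho> \<Longrightarrow> F x \<in> car M \<sigma>) \<Longrightarrow> fn M \<rho> \<sigma> F \<in> car M (\<rho> \<rightarrow> \<sigma>)"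
  using fn_props by blast

lemma app_fn:
  "x \<in> car M \<rho> \<Longrightarrow> (\<And>x. x \<in> car M \<rho> \<Longrightarrow> F x \<in> car M \<sigma>) \<Longrightarrow> app M (fn M \<rho> \<sigma> F) x = F x"
  using fn_props by blast

lemma els_car: "B \<in> car M (Star \<sigma>) \<Longrightarrow> els M B \<noteq> {} \<and> finite (els M B) \<and> els M B \<subseteq> car M \<sigma>"
  using bij_betwE[OF bij_els] by blast

lemma fset_props:
  assumes "X \<noteq> {}" "finite X" "X \<subseteq> car M \<sigma>"
  shows "fset M \<sigma> X \<in> car M (Star \<sigma>) \<and> els M (fset M \<sigma> X) = X"
  unfolding fset_def
proof (rule theI', rule ex_ex1I)
  have "X \<in> els M ` car M (Star \<sigma>)"
    using assms unfolding bij_betw_imp_surj_on[OF bij_els] by simp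
  then show "\<exists>s. s \<in> car M (Star \<sigma>) \<and> els M s = X" by blast
next
  fix s t
  assume "s \<in> car M (Star \<sigma>) \<and> els M s = X" "t \<in> car M (Star \<sigma>) \<and> els M t = X"
  then show "s = t" by (intro inj_onD[OF bij_betw_imp_inj_on[OF bij_els]]) auto
qed

lemmas fset_car = fset_props[THEN conjunct1] and els_fset = fset_props[THEN conjunct2]

lemma rec_nat_car:
  assumes "x \<in> car M \<sigma>" "y \<in> car M (tyN \<rightarrow> \<sigma> \<rightarrow> \<sigma>)"
  shows "rec_nat x (\<lambda>k r. app M (app M y (natv M k)) r) n \<in> car M \<sigma>"
  using assms by (induction n) (simp_all add: app_car[OF app_car])

lemma app_app_car:
  assumes "x \<in> car M (\<rho> \<rightarrow> \<sigma> \<rightarrow> \<tau>)" "y \<in> car M (\<rho> \<rightarrow> \<sigma>)" "z \<in> car M \<rho>"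
  shows "app M (app M x z) (app M y z) \<in> car M \<tau>"
  using assms by (meson app_car)

text \<open>Each function must map into the right carrier. The cases singled out are those that need
  a fact of their own: iteration for the recursor, nested application for S, and non-emptiness and
  finiteness for the unions.\<close>

lemma const_val_car: "const_val M c \<in> car M (const_ty c)"
proof (cases c)
  case (cRec \<sigma>)
  then show ?thesis by (auto intro!: fn_car rec_nat_car)
next
  case (cIUnion \<rho> \<sigma>)
  have "fset M \<sigma> (\<Union>z\<in>els M x. els M (app M f z)) \<in> car M (Star \<sigma>)"
    if "x \<in> car M (Star \<rho>)" "f \<in> car M (\<rho> \<rightarrow> Star \<sigma>)" for x f
  proof -
    have "els M (app M f z) \<noteq> {} \<and> finite (els M (app M f z)) \<and> els M (app M f z) \<subseteq> car M \<sigma>"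
      if "z \<in> els M x" for z
      using els_car[OF \<open>x \<in> _\<close>] app_car[OF \<open>f \<in> _\<close>] els_car that by blast
    then show ?thesis using els_car[OF that(1)] by (intro fset_car) auto
  qed
  then show ?thesis using cIUnion by (auto intro!: fn_car)
next
  case (cUnion \<sigma>)
  then show ?thesis using els_car by (auto intro!: fn_car fset_car)
next
  case (cS \<rho> \<sigma> \<tau>)
  then show ?thesis by (auto intro!: fn_car app_app_car)
qed (auto intro!: fn_car fset_car)

text \<open>The empty context is stated as an equation so that rule induction applies; the case of
  variables is then vacuous and \<open>e\<close> may be arbitrary.\<close>

lemma val_car: "typed \<Gamma> t \<sigma> \<Longrightarrow> \<Gamma> = [] \<Longrightarrow> val M e t \<in> car M \<sigma>"
  by (induction rule: typed.induct) (simp_all add: const_val_car app_car)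

section \<open>Computation rules for the constants\<close>

lemma app_K:
  assumes "x \<in> car M \<rho>" "y \<in> car M \<sigma>"
  shows "app M (app M (const_val M (cK \<rho> \<sigma>)) x) y = x"
  using assms by (simp add: app_fn fn_car)

lemma app_S:
  assumes "x \<in> car M (\<rho> \<rightarrow> \<sigma> \<rightarrow> \<tau>)" "y \<in> car M (\<rho> \<rightarrow> \<sigma>)" "z \<in> car M \<rho>"
  shows "app M (app M (app M (const_val M (cS \<rho> \<sigma> \<tau>)) x) y) z = app M (app M x z) (app M y z)"
  using assms by (simp add: app_fn fn_car app_app_car)

lemma app_Sing: "x \<in> car M \<sigma> \<Longrightarrow> app M (const_val M (cSing \<sigma>)) x = fset M \<sigma> {x}"
  by (simp add: app_fn fset_car)

lemma app_Max:
  "x \<in> car M (Star tyN) \<Longrightarrow> app M (const_val M cMax) x = natv M (Max (natof M ` els M x))"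
  by (simp add: app_fn)

lemma memb_iff: "x \<in> car M \<sigma> \<Longrightarrow> B \<in> car M (Star \<sigma>) \<Longrightarrow> memb M \<sigma> x B \<longleftrightarrow> x \<in> els M B"
  by (simp add: memb_def app_fn fn_car)

lemma app_Rec:
  assumes "x \<in> car M \<sigma>" "y \<in> car M (tyN \<rightarrow> \<sigma> \<rightarrow> \<sigma>)"
  shows "app M (app M (app M (const_val M (cRec \<sigma>)) x) y) (natv M n) =
    rec_nat x (\<lambda>k r. app M (app M y (natv M k)) r) n"
  using assms by (simp add: app_fn fn_car rec_nat_car)

lemma app_pred: "app M (val M e pred_tm) (natv M n) = natv M (n - 1)"
proof (induction n)
  case (Suc n)
  have "const_val M (cK tyN tyN) \<in> car M (tyN \<rightarrow> tyN \<rightarrow> tyN)"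
    using const_val_car[of "cK tyN tyN"] by simp
  from app_Rec[OF natv_car this] Suc show ?case
    \<comment> \<open>The values of K and of the recursor stay folded so that their computation
      rules can fire. The step function K returns the counter, which is the predecessor.\<close>
    unfolding pred_tm_def by (simp add: app_K del: const_val.simps(1,5))
next
  case 0
  have "const_val M (cK tyN tyN) \<in> car M (tyN \<rightarrow> tyN \<rightarrow> tyN)"
    using const_val_car[of "cK tyN tyN"] by simp
  from app_Rec[OF natv_car this] show ?case
    unfolding pred_tm_def by (simp del: const_val.simps(1,5))
qed

lemma typed_pred_tm: "typed \<Gamma> pred_tm (tyN \<rightarrow> tyN)"
  unfolding pred_tm_def by (rule typed_App typed_Con | simp)+

lemma lev_natv: "lev M (natv M a) (natv M b) \<longleftrightarrow> a \<le> b"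
proof -
  let ?c = "Con (cK (tyN \<rightarrow> tyN) tyN) \<bullet> pred_tm"
  have "typed [] ?c (tyN \<rightarrow> tyN \<rightarrow> tyN)"
    by (rule typed_App typed_Con typed_pred_tm | simp)+
  then have c: "val M e ?c \<in> car M (tyN \<rightarrow> tyN \<rightarrow> tyN)" for e by (blast intro: val_car)
  have K: "app M (app M (const_val M (cK (tyN \<rightarrow> tyN) tyN)) (val M e pred_tm)) (natv M k) =
      val M e pred_tm" for e k
    by (rule app_K) (auto intro: val_car typed_pred_tm)
  have "rec_nat (natv M a) (\<lambda>k r. app M (app M (val M e ?c) (natv M k)) r) b = natv M (a - b)" for e
    by (induction b) (simp_all add: K app_pred del: const_val.simps(1))
  then show ?thesis
    unfolding lev_def monus_def by (simp add: app_Rec[OF natv_car c[unfolded val.simps]] del: const_val.simps(1,5))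
qed

text \<open>A tuple chosen componentwise from singletons is the tuple of their elements. Answering
  with singletons thus means issuing one definite challenge.\<close>

lemma tb_sing:
  assumes "in_car M vs \<sigma>s"
  shows "tb M \<sigma>s (map2 (\<lambda>\<sigma> v. fset M \<sigma> {v}) \<sigma>s vs) P \<longleftrightarrow> P vs"
proof -
  have "(\<forall>i<length \<sigma>s. memb M (\<sigma>s ! i) (xs ! i) (map2 (\<lambda>\<sigma> v. fset M \<sigma> {v}) \<sigma>s vs ! i)) \<longleftrightarrow> xs = vs"
    if "in_car M xs \<sigma>s" for xs
    using assms that
    by (auto simp: list_all2_conv_all_nth memb_iff fset_car els_fset intro: nth_equalityI)
  then show ?thesis using assms unfolding tb_def by auto
qed

end

section \<open>Closed terms\<close>

definition compose_tm :: "ty \<Rightarrow> ty \<Rightarrow> ty \<Rightarrow> tm \<Rightarrow> tm \<Rightarrow> tm" where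
  "compose_tm \<rho> \<sigma> \<tau> f g = Con (cS \<rho> \<sigma> \<tau>) \<bullet> (Con (cK (\<sigma> \<rightarrow> \<tau>) \<rho>) \<bullet> f) \<bullet> g"

primrec const_tm :: "ty list \<Rightarrow> ty \<Rightarrow> tm \<Rightarrow> tm" where
  "const_tm [] \<tau> t = t"
| "const_tm (\<sigma> # \<sigma>s) \<tau> t = Con (cK (arrs \<sigma>s \<tau>) \<sigma>) \<bullet> const_tm \<sigma>s \<tau> t"

text \<open>Takes a value and then arguments of types \<open>\<sigma>s\<close>, and returns the
  value. The base case is the identity in the form S K K.\<close>

primrec first_tm :: "ty list \<Rightarrow> ty \<Rightarrow> tm" where
  "first_tm [] \<tau> = Con (cS \<tau> (\<tau> \<rightarrow> \<tau>) \<tau>) \<bullet> Con (cK \<tau> (\<tau> \<rightarrow> \<tau>)) \<bullet> Con (cK \<tau> \<tau>)"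
| "first_tm (\<sigma> # \<sigma>s) \<tau> =
    compose_tm \<tau> (arrs \<sigma>s \<tau>) (\<sigma> \<rightarrow> arrs \<sigma>s \<tau>) (Con (cK (arrs \<sigma>s \<tau>) \<sigma>)) (first_tm \<sigma>s \<tau>)"

text \<open>Represents the map sending a tuple to \<open>h\<close> applied to its
  \<open>i\<close>-th component: \<open>const_tm\<close> consumes the components before it, and
  \<open>first_tm\<close> discards those after it.\<close>

definition proj_tm :: "ty list \<Rightarrow> nat \<Rightarrow> ty \<Rightarrow> tm \<Rightarrow> tm" where
  "proj_tm \<sigma>s i \<tau> h =
    (let rest = drop (Suc i) \<sigma>s in
     const_tm (take i \<sigma>s) (\<sigma>s ! i \<rightarrow> arrs rest \<tau>)
       (compose_tm (\<sigma>s ! i) \<tau> (arrs rest \<tau>) (first_tm rest \<tau>) h))"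

text \<open>Supplies arbitrary closed witnesses of any prescribed type.\<close>

primrec inhabitant :: "ty \<Rightarrow> tm" where
  "inhabitant tyN = Con cZero"
| "inhabitant tyB = Con cTrue"
| "inhabitant (\<rho> \<rightarrow> \<sigma>) = Con (cK \<sigma> \<rho>) \<bullet> inhabitant \<sigma>"
| "inhabitant (Star \<sigma>) = Con (cSing \<sigma>) \<bullet> inhabitant \<sigma>"

lemma typed_compose_tm:
  "typed \<Gamma> f (\<sigma> \<rightarrow> \<tau>) \<Longrightarrow> typed \<Gamma> g (\<rho> \<rightarrow> \<sigma>) \<Longrightarrow> typed \<Gamma> (compose_tm \<rho> \<sigma> \<tau> f g) (\<rho> \<rightarrow> \<tau>)"
  unfolding compose_tm_def by (rule typed_App typed_Con | assumption | simp)+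

lemma typed_const_tm: "typed \<Gamma> t \<tau> \<Longrightarrow> typed \<Gamma> (const_tm \<sigma>s \<tau> t) (arrs \<sigma>s \<tau>)"
  by (induction \<sigma>s) (auto intro!: typed_App typed_Con)

lemma typed_first_tm: "typed \<Gamma> (first_tm \<sigma>s \<tau>) (\<tau> \<rightarrow> arrs \<sigma>s \<tau>)"
proof (induction \<sigma>s)
  case Nil
  show ?case unfolding first_tm.simps arrs_Nil by (rule typed_App typed_Con | simp)+
next
  case (Cons \<sigma> \<sigma>s)
  then show ?case by (auto intro!: typed_compose_tm typed_Con)
qed

lemma typed_inhabitant: "typed \<Gamma> (inhabitant \<sigma>) \<sigma>"
  by (induction \<sigma>) (auto intro!: typed_App typed_Con)

lemma typed_proj_tm:
  assumes "i < length \<sigma>s" "typed \<Gamma> h (\<sigma>s ! i \<rightarrow> \<tau>)"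
  shows "typed \<Gamma> (proj_tm \<sigma>s i \<tau> h) (arrs \<sigma>s \<tau>)"
proof -
  have "arrs \<sigma>s \<tau> = arrs (take i \<sigma>s) (\<sigma>s ! i \<rightarrow> arrs (drop (Suc i) \<sigma>s) \<tau>)"
    by (subst id_take_nth_drop[OF assms(1)]) (simp add: arrs_append)
  then show ?thesis
    using assms(2) unfolding proj_tm_def Let_def
    by (auto intro!: typed_const_tm typed_compose_tm typed_first_tm)
qed

section \<open>Values of the closed terms in full structures\<close>

context
  fixes M :: "'u type_structure"
  assumes full: "full_structure M"
begin

lemma val_compose_tm:
  assumes "typed [] f (\<sigma> \<rightarrow> \<tau>)" "typed [] g (\<rho> \<rightarrow> \<sigma>)" "x \<in> car M \<rho>"
  shows "app M (val M e (compose_tm \<rho> \<sigma> \<tau> f g)) x = app M (val M e f) (app M (val M e g) x)"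
proof -
  have "val M e (Con (cK (\<sigma> \<rightarrow> \<tau>) \<rho>) \<bullet> f) \<in> car M (\<rho> \<rightarrow> \<sigma> \<rightarrow> \<tau>)"
    by (rule val_car[OF full _ refl]) (auto intro!: typed_App typed_Con assms)
  with assms val_car[OF full] show ?thesis
    unfolding compose_tm_def by (simp add: app_S[OF full] app_K[OF full] del: const_val.simps)
qed

lemma val_const_tm:
  assumes "typed [] t \<tau>" "in_car M vs \<sigma>s"
  shows "appl M (val M e (const_tm \<sigma>s \<tau> t)) vs = val M e t"
  using assms(2)
proof (induction vs \<sigma>s rule: list_all2_induct)
  case (Cons v vs \<sigma> \<sigma>s)
  then show ?case
    by (simp add: app_K[OF full] val_car[OF full typed_const_tm[OF assms(1)]] del: const_val.simps)
qed simp

lemma val_first_tm: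
  assumes "x \<in> car M \<tau>" "in_car M vs \<sigma>s"
  shows "appl M (app M (val M e (first_tm \<sigma>s \<tau>)) x) vs = x"
  using assms(2)
proof (induction vs \<sigma>s rule: list_all2_induct)
  case Nil
  have "const_val M (cK \<tau> (\<tau> \<rightarrow> \<tau>)) \<in> car M (\<tau> \<rightarrow> (\<tau> \<rightarrow> \<tau>) \<rightarrow> \<tau>)"
    "const_val M (cK \<tau> \<tau>) \<in> car M (\<tau> \<rightarrow> \<tau> \<rightarrow> \<tau>)"
    using const_val_car[OF full, of "cK _ _"] by auto
  with assms(1) show ?case
    by (simp add: app_S[OF full] app_K[OF full] app_car[OF full, of _ \<tau>] del: const_val.simps)
next
  case (Cons v vs \<sigma> \<sigma>s)
  have "app M (val M e (first_tm \<sigma>s \<tau>)) x \<in> car M (arrs \<sigma>s \<tau>)"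
    by (rule app_car[OF full val_car[OF full typed_first_tm refl] assms(1)])
  moreover have "typed [] (Con (cK (arrs \<sigma>s \<tau>) \<sigma>)) (arrs \<sigma>s \<tau> \<rightarrow> \<sigma> \<rightarrow> arrs \<sigma>s \<tau>)"
    by (simp add: typed_Con)
  ultimately show ?case using Cons assms(1)
    by (simp add: val_compose_tm[OF _ typed_first_tm] app_K[OF full] del: const_val.simps)
qed

lemma val_proj_tm:
  assumes "i < length \<sigma>s" "typed [] h (\<sigma>s ! i \<rightarrow> \<tau>)" "in_car M vs \<sigma>s"
  shows "appl M (val M e (proj_tm \<sigma>s i \<tau> h)) vs = app M (val M e h) (vs ! i)"
proof -
  let ?rest = "drop (Suc i) \<sigma>s"
  have vi: "vs ! i \<in> car M (\<sigma>s ! i)" "i < length vs"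
    and vs: "in_car M (take i vs) (take i \<sigma>s)" "in_car M (drop (Suc i) vs) ?rest"
    using assms(1,3) by (auto simp: list_all2_conv_all_nth)
  have first: "typed [] (first_tm ?rest \<tau>) (\<tau> \<rightarrow> arrs ?rest \<tau>)"
    by (rule typed_first_tm)
  have "app M (val M e h) (vs ! i) \<in> car M \<tau>"
    using app_car[OF full val_car[OF full assms(2) refl] vi(1)] .
  \<comment> \<open>The argument tuple is split at position \<open>i\<close>, matching the three
    layers of \<open>proj_tm\<close>.\<close>
  then have "appl M (val M e (proj_tm \<sigma>s i \<tau> h)) (take i vs @ vs ! i # drop (Suc i) vs) =
      app M (val M e h) (vs ! i)"
    unfolding proj_tm_def Let_def
    by (simp add: val_const_tm[OF typed_compose_tm[OF first assms(2)] vs(1)]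
        val_compose_tm[OF first assms(2) vi(1)] val_first_tm[OF _ vs(2)])
  then show ?thesis by (simp flip: id_take_nth_drop[OF vi(2)])
qed

end

section \<open>Reduction to the semantic interpretation\<close>

lemma pos_ialls [simp]: "pos (ialls \<Gamma> A) = pos A" and neg_ialls [simp]: "neg (ialls \<Gamma> A) = neg A"
  by (induction \<Gamma> arbitrary: A) auto

lemma iwf_ialls: "iwf \<Gamma> (ialls \<sigma>s A) = iwf (\<sigma>s @ \<Gamma>) A"
  by (induction \<sigma>s arbitrary: A) auto

lemma isem_ialls:
  "isem M (ialls \<sigma>s A) e as bs \<longleftrightarrow> (\<forall>xs. in_car M xs \<sigma>s \<longrightarrow> isem M A (env xs e) as bs)"
  by (induction \<sigma>s arbitrary: A) (auto simp: case_nat_env list_all2_Cons2)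

lemma iwf_iconj: "(\<And>A. A \<in> set As \<Longrightarrow> iwf \<Gamma> A) \<Longrightarrow> iwf \<Gamma> (iconj As)"
  by (induction As rule: iconj.induct) auto

definition params :: "ty list \<Rightarrow> ifm" where
  "params \<Gamma> = iconj (map (\<lambda>i. IPred (\<Gamma> ! i) (Var i)) [0..<length \<Gamma>])"

lemma iwf_params: "iwf \<Gamma> (params \<Gamma>)"
  unfolding params_def by (rule iwf_iconj) (auto intro: typed_Var)

lemma typed_weaken: "typed \<Gamma> t \<sigma> \<Longrightarrow> \<Gamma> = [] \<Longrightarrow> typed \<Delta> t \<sigma>"
  by (induction rule: typed.induct) (auto intro: typed.intros)

text \<open>Leaves only the semantic condition to be checked. There are two environments because the
  closed terms are evaluated with the values of the negative arguments in front, while the formula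
  is read in the environment without them.\<close>

lemma U_interpretableI:
  assumes "iwf [] A" "list_all2 (typed []) ts (pos A)"
    and "\<And>e e' bs. in_car M bs (neg A) \<Longrightarrow> isem M A e (map (val M e') ts) bs"
  shows "U_interpretable M [] A"
proof -
  have "list_all2 (\<lambda>t \<tau>. witnessing_ty \<tau> \<and> typed [] t \<tau>) ts (pos A)"
    using assms(2) witnessing_pos_neg[of A] by (auto simp: list_all2_conv_all_nth)
  moreover have "twf [] (talls (neg A) (interp (ishift (length (neg A)) A) ts (vars (length (neg A)))))"
  proof -
    have "list_all2 (typed (neg A @ [])) ts (pos A)"
      using assms(2) by (rule list_all2_mono) (blast intro: typed_weaken)
    then show ?thesis
      \<comment> \<open>The context is kept in the form \<open>neg A @ []\<close>, which is the form
        that \<open>iwf_ishift\<close> and \<open>typed_vars\<close> produce.\<close>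
      unfolding twf_talls by (intro twf_interp) (simp_all add: iwf_ishift assms(1) typed_vars del: append_Nil2)
  qed
  moreover have "sat M e (talls (neg A) (interp (ishift (length (neg A)) A) ts (vars (length (neg A)))))" for e
    unfolding sat_talls
  proof (intro allI impI)
    fix xs
    assume xs: "in_car M xs (neg A)"
    then have l: "length (neg A) = length xs" by (simp add: list_all2_lengthD)
    then show "sat M (env xs e) (interp (ishift (length (neg A)) A) ts (vars (length (neg A))))"
      using assms(2)[THEN list_all2_lengthD] assms(3)[OF xs]
      by (subst sat_interp) (simp_all add: isem_ishift val_vars, simp_all add: vars_def)
  qed
  ultimately show ?thesis
    unfolding U_interpretable_def by (auto simp: Let_def theory_of_def)
qed

text \<open>The condition \<open>sem\<close> asks for the relativized formula in every environment,
  so the implication from the predicates on the parameters holds outright. The terms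
  \<open>ws\<close> receive the witnesses of the parameters as leading arguments.\<close>

lemma I_interpretableI:
  assumes full: "full_structure M" and "swf \<Gamma> A"
    and ws: "list_all2 (typed []) ws (map (arrs (pos (params \<Gamma>))) (pos (rel A)))"
    and sem: "\<And>e e' as ds. in_car M as (pos (params \<Gamma>)) \<Longrightarrow> in_car M ds (neg (rel A)) \<Longrightarrow>
      isem M (rel A) e (map (\<lambda>w. appl M (val M e' w) as) ws) ds"
  shows "I_interpretable M \<Gamma> A"
proof -
  let ?as = "pos (params \<Gamma>)" and ?bs = "neg (params \<Gamma>)"
  \<comment> \<open>The sets of challenges to the parameters may be anything of the right type, so
    \<open>inhabitant\<close> provides them.\<close>
  let ?ts = "ws @ map (\<lambda>\<beta>. inhabitant (arrs (?as @ neg (rel A)) (Star \<beta>))) ?bs"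
  have "list_all2 (typed []) ?ts (pos_imp ?as ?bs (pos (rel A)) (neg (rel A)))"
    unfolding pos_imp_def
    by (rule list_all2_appendI[OF ws]) (simp add: list_all2_conv_all_nth typed_inhabitant)
  moreover have "isem M (IImp (params \<Gamma>) (rel A)) e (map (val M e') ?ts) bs"
    if "in_car M bs (?as @ neg (rel A))" for e e' bs
    using sem[OF list_all2_split[OF that], of e e'] ws[THEN list_all2_lengthD]
    by (simp add: comp_def)
  ultimately show ?thesis
    unfolding I_interpretable_def params_def[symmetric]
    by (intro U_interpretableI[where ts = ?ts and M = M])
      (auto simp: iwf_ialls iwf_params iwf_rel assms(2) isem_ialls simp del: isem.simps map_append)
qed

section \<open>Contra-collection\<close>

lemma lev_Max:
  assumes full: "full_structure M" and "N \<in> car M (Star tyN)" "x \<in> els M N" "y \<in> car M tyN" "lev M y x"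
  shows "lev M y (natv M (Max (natof M ` els M N)))"
proof -
  obtain a b where ab: "x = natv M a" "y = natv M b"
    using assms els_car[OF full assms(2)] by (meson car_natE subsetD)
  have "a \<le> Max (natof M ` els M N)"
    using els_car[OF full assms(2)] assms(3) ab natof_natv[OF full]
    by (intro Max_ge) (auto simp: image_iff intro!: bexI[of _ x])
  then show ?thesis using assms(5) ab lev_natv[OF full] by auto
qed

lemma swf_sren: "swf \<Gamma> A \<Longrightarrow> ren_ok r \<Gamma> \<Delta> \<Longrightarrow> swf \<Delta> (sren r A)"
proof -
  have "source_tm t \<Longrightarrow> source_tm (ren r t)" for r t
    by (induction t) auto
  then show "swf \<Gamma> A \<Longrightarrow> ren_ok r \<Gamma> \<Delta> \<Longrightarrow> swf \<Delta> (sren r A)"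
    by (induction A arbitrary: r \<Gamma> \<Delta>) (auto intro: typed_ren ren_ok_up)
qed

lemma swf_contra_collection:
  assumes "swf (tyN # (tyN \<rightarrow> tyN) # \<Gamma>) C"
  shows "swf \<Gamma> (contra_collection C)"
proof -
  \<comment> \<open>Only the parameters move, past the new variable \<open>k\<close>; the two
    applications of \<open>up\<close> leave \<open>n\<close> and \<open>f\<close> in place.\<close>
  have "ren_ok Suc \<Gamma> (tyN # \<Gamma>)" by (simp add: ren_ok_def)
  from swf_sren[OF assms ren_ok_up[OF ren_ok_up[OF this]]] assms show ?thesis
    by (auto simp: contra_collection_def intro: typed_Var)
qed

text \<open>The conclusion is challenged by tests of \<open>f \<le> 1\<close>, bounds on
  \<open>n\<close> and challenges to \<open>C\<close>, each as a finite set. The premise is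
  challenged by a bound on \<open>k\<close>, a set of tests and sets of challenges to
  \<open>C\<close>. The only positive witnesses map the former to finite sets of the latter.\<close>

lemma contra_collection_witness_types:
  assumes "pos (rel C) = []"
  shows "pos (rel (contra_collection C)) =
      map (\<lambda>\<beta>. arrs (Star tyN # Star tyN # map Star (neg (rel C))) (Star \<beta>))
        (tyN # Star tyN # map Star (neg (rel C)))"
    and "neg (rel (contra_collection C)) = Star tyN # Star tyN # map Star (neg (rel C))"
  using assms by (simp_all add: contra_collection_def pos_imp_def ile_def ile1_def rel_sren)

lemma pos_ile1: "pos ile1 = []" and neg_ile1: "neg ile1 = [tyN]"
  by (simp_all add: ile1_def ile_def pos_imp_def)

lemma isem_contra_collection:
  assumes full: "full_structure M" and C: "pos (rel C) = []"
    and N: "N \<in> car M (Star tyN)" and B: "B \<in> car M (Star tyN)"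
    and Ds: "in_car M Ds (map Star (neg (rel C)))"
    and gs: "map (\<lambda>g. appl M g (B # N # Ds)) gs =
      map2 (\<lambda>\<sigma> v. fset M \<sigma> {v}) (tyN # Star tyN # map Star (neg (rel C)))
        (natv M (Max (natof M ` els M N)) # B # Ds)"
  shows "isem M (rel (contra_collection C)) e gs (B # N # Ds)"
proof -
  define \<beta>s where "\<beta>s = neg (rel C)"
  define K where "K = natv M (Max (natof M ` els M N))"
  let ?P = "rel (SAll tyN (SExLe1 (SAllLe (Var 1) (sren (up (up Suc)) C))))"
  let ?Q = "rel (SExLe1 (SAll tyN C))"
  have K: "K \<in> car M tyN" "lev M K K"
    unfolding K_def by (simp_all add: natv_car[OF full] lev_natv[OF full])
  have neg: "neg ?P = tyN # Star tyN # map Star \<beta>s" and pos: "pos ?P = []" "pos ?Q = []"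
    using C by (simp_all add: pos_imp_def ile_def ile1_def rel_sren \<beta>s_def)
  \<comment> \<open>Dropping \<open>k\<close> from the environment makes the copy of
    \<open>C\<close> in the premise and \<open>C\<close> in the conclusion the same
    condition.\<close>
  have e: "case_nat k e \<circ> Suc = e" for k :: 'a and e by auto
  have "isem M ?Q e [] (B # N # Ds)" if "isem M ?P e [] (K # B # Ds)"
  proof -
    \<comment> \<open>The interpreted \<open>f \<le> 1\<close> against a single test
      \<open>m\<close>: the inequality is required at all arguments up to \<open>m\<close>.\<close>
    define bound where "bound f m \<longleftrightarrow> (\<forall>x\<in>car M tyN. lev M x m \<longrightarrow>
      lev M (app M f x) (val M (\<lambda>_. x) one_tm))" for f m
    have bound_ile1: "isem M ile1 (case_nat f e) [] bs \<longleftrightarrow> bound f (hd bs)"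
      if "length bs > 0" for f bs e
      using that
      by (simp add: ile1_def ile_def val_monus_eq bound_def pos_imp_def one_tm_def)
    \<comment> \<open>The premise is used at \<open>k\<close> equal to its own bound
      \<open>K\<close>, which is allowed by \<open>lev M K K\<close>.\<close>
    have "\<exists>f\<in>car M (tyN \<rightarrow> tyN). tb M (tyN # \<beta>s) (B # Ds) (\<lambda>bs. bound f (hd bs) \<and>
        (\<forall>n\<in>car M tyN. lev M n K \<longrightarrow> isem M (rel C) (case_nat n (case_nat f e)) [] (drop 1 bs)))"
      using that K C
      by (simp add: pos_imp_def ile_def val_monus_eq rel_sren isem_iren case_nat_up e
          bound_ile1 \<beta>s_def pos_ile1 neg_ile1 val_shift1[simplified] cong: tb_cong)
    then obtain f where f: "f \<in> car M (tyN \<rightarrow> tyN)" and fb: "tb M (tyN # \<beta>s) (B # Ds) (\<lambda>bs. bound f (hd bs) \<and>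
        (\<forall>n\<in>car M tyN. lev M n K \<longrightarrow> isem M (rel C) (case_nat n (case_nat f e)) [] (drop 1 bs)))"
      by blast
    \<comment> \<open>Compared with the premise, a challenge now has an extra entry, the bound on
      \<open>n\<close>, in second place; hence \<open>drop 2\<close> where the premise has
      \<open>drop 1\<close>.\<close>
    have "tb M (tyN # tyN # \<beta>s) (B # N # Ds) (\<lambda>bs. bound f (hd bs) \<and>
        (\<forall>n\<in>car M tyN. lev M n (hd (drop 1 bs)) \<longrightarrow>
          isem M (rel C) (case_nat n (case_nat f e)) [] (drop 2 bs)))"
      unfolding tb_def
    proof (intro allI impI)
      fix xs
      assume xs: "in_car M xs (tyN # tyN # \<beta>s)" and m: "\<forall>i<length (tyN # tyN # \<beta>s).
        memb M ((tyN # tyN # \<beta>s) ! i) (xs ! i) ((B # N # Ds) ! i)"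
      from xs obtain m n ds where xs_eq: "xs = m # n # ds"
        and car: "m \<in> car M tyN" "n \<in> car M tyN" "in_car M ds \<beta>s"
        by (auto simp: list_all2_Cons2)
      have n: "n \<in> els M N"
        using m[rule_format, of 1] car(2) N by (simp add: xs_eq memb_iff[OF full])
      have "\<forall>i<length (tyN # \<beta>s). memb M ((tyN # \<beta>s) ! i) ((m # ds) ! i) ((B # Ds) ! i)"
      proof (intro allI impI)
        fix i assume "i < length (tyN # \<beta>s)"
        then show "memb M ((tyN # \<beta>s) ! i) ((m # ds) ! i) ((B # Ds) ! i)"
          \<comment> \<open>The head keeps its index, and every later entry moves by one because the
            bound on \<open>n\<close> is left out.\<close>
          using m[rule_format, of 0] m[rule_format, of "Suc i"] by (cases i) (auto simp: xs_eq)
      qed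
      then have "bound f m \<and>
          (\<forall>n\<in>car M tyN. lev M n K \<longrightarrow> isem M (rel C) (case_nat n (case_nat f e)) [] ds)"
        using fb[unfolded tb_def, THEN spec, THEN mp, of "m # ds"] car by simp
      then show "bound f (hd xs) \<and> (\<forall>n\<in>car M tyN. lev M n (hd (drop 1 xs)) \<longrightarrow>
          isem M (rel C) (case_nat n (case_nat f e)) [] (drop 2 xs))"
        \<comment> \<open>Whatever lies below the bound chosen from \<open>N\<close> lies below the
          maximum \<open>K\<close>, where \<open>C\<close> is already secured.\<close>
        using lev_Max[OF full N n, folded K_def] by (simp add: xs_eq)
    qed
    then have "tb M (neg (IAnd ile1 (rel (SAll tyN C)))) (B # N # Ds)
        (isem M (IAnd ile1 (rel (SAll tyN C))) (case_nat f e) [])"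
      using C by (simp add: pos_imp_def \<beta>s_def pos_ile1 neg_ile1 bound_ile1 numeral_2_eq_2 cong: tb_cong)
    with f show ?thesis unfolding rel.simps(10) isem.simps(7) by blast
  qed
  moreover have "isem M (rel (contra_collection C)) e gs (B # N # Ds) \<longleftrightarrow>
      (tb M (neg ?P) (map (\<lambda>g. appl M g (B # N # Ds)) gs) (isem M ?P e []) \<longrightarrow>
       isem M ?Q e [] (B # N # Ds))"
    unfolding contra_collection_def rel.simps(4) isem.simps(5) pos by simp
  moreover have "in_car M (K # B # Ds) (tyN # Star tyN # map Star \<beta>s)"
    using K B Ds by (simp add: \<beta>s_def)
  ultimately show ?thesis
    \<comment> \<open>By \<open>gs\<close> the challenges to the premise are singletons, so
      \<open>tb_sing\<close> reduces its bounded block to the one tuple treated above.\<close>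
    unfolding neg gs K_def[symmetric] \<beta>s_def[symmetric] by (simp only: tb_sing[OF full]) blast
qed

theorem theorem9p19:
  fixes M :: "'u type_structure" and \<Gamma> :: "ty list" and C :: sfm
  assumes "full_structure M"
    and "\<forall>\<sigma>\<in>set \<Gamma>. star_free \<sigma>"
    and "swf (tyN # (tyN \<rightarrow> tyN) # \<Gamma>) C"
    and "no_positive_I_witnesses C"
  shows "I_interpretable M \<Gamma> (contra_collection C)"
proof -
  have C: "pos (rel C) = []" using assms(4) by (simp add: no_positive_I_witnesses_def)
  define as where "as = pos (params \<Gamma>)"
  define \<beta>s where "\<beta>s = neg (rel C)"
  define qs where "qs = Star tyN # Star tyN # map Star \<beta>s"
  define ps where "ps = tyN # Star tyN # map Star \<beta>s"
  \<comment> \<open>The offset \<open>length as\<close> skips the witnesses of the parameters, so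
    \<open>i\<close> counts within the challenge to the conclusion.\<close>
  define pr where "pr i \<beta> h = proj_tm (as @ qs) (length as + i) (Star \<beta>) h" for i \<beta> h
  define max where "max = compose_tm (Star tyN) tyN (Star tyN) (Con (cSing tyN)) (Con cMax)"
  \<comment> \<open>The answers follow the order of the challenge to the premise, whereas the
    indices refer to the conclusion: 1 is \<open>N\<close>, 0 is \<open>B\<close>, and from 2 on
    come the challenges to \<open>C\<close>.\<close>
  define ws where "ws = pr 1 tyN max # pr 0 (Star tyN) (Con (cSing (Star tyN))) #
    map (\<lambda>i. pr (i + 2) (Star (\<beta>s ! i)) (Con (cSing (Star (\<beta>s ! i))))) [0..<length \<beta>s]"
  have max: "typed [] max (Star tyN \<rightarrow> Star tyN)"
    unfolding max_def by (auto intro!: typed_compose_tm typed_Con)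
  have typed_pr: "typed [] (pr i \<beta> h) (arrs as (arrs qs (Star \<beta>)))"
    if "i < length qs" "typed [] h (qs ! i \<rightarrow> Star \<beta>)" for i \<beta> h
    using that typed_proj_tm[of "length as + i" "as @ qs" "[]" h]
    unfolding pr_def by (simp add: arrs_append)
  \<comment> \<open>The two successive applications combine into one to the concatenated tuple, to
    which \<open>val_proj_tm\<close> applies.\<close>
  have val_pr: "appl M (appl M (val M e (pr i \<beta> h)) avs) vs = app M (val M e h) (vs ! i)"
    if "i < length qs" "typed [] h (qs ! i \<rightarrow> Star \<beta>)" "in_car M avs as" "in_car M vs qs" for i \<beta> h e avs vs
    using val_proj_tm[OF assms(1), of "length as + i" "as @ qs" h "Star \<beta>" "avs @ vs" e] that
    unfolding pr_def by (simp add: list_all2_appendI nth_append list_all2_lengthD)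
  show ?thesis
  proof (rule I_interpretableI[OF assms(1) swf_contra_collection[OF assms(3)]])
    show "list_all2 (typed []) ws (map (arrs (pos (params \<Gamma>))) (pos (rel (contra_collection C))))"
      unfolding contra_collection_witness_types[OF C] as_def[symmetric] \<beta>s_def[symmetric] qs_def[symmetric]
      unfolding ws_def
      by (auto simp: list_all2_conv_all_nth[of _ "map _ _"] simp del: arrs_Cons intro!: typed_pr)
        (auto simp: qs_def max intro: typed_Con)
  next
    fix e e' avs vs
    assume avs: "in_car M avs (pos (params \<Gamma>))" and "in_car M vs (neg (rel (contra_collection C)))"
    then obtain B N Ds where vs: "vs = B # N # Ds" and
      N: "N \<in> car M (Star tyN)" and B: "B \<in> car M (Star tyN)" and Ds: "in_car M Ds (map Star \<beta>s)"
      unfolding contra_collection_witness_types[OF C] by (auto simp: list_all2_Cons2 \<beta>s_def)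
    show "isem M (rel (contra_collection C)) e (map (\<lambda>w. appl M (val M e' w) avs) ws) vs"
      unfolding vs
    proof (rule isem_contra_collection[OF assms(1) C N B Ds[unfolded \<beta>s_def]])
      have "in_car M avs as" "in_car M (B # N # Ds) qs"
        using avs N B Ds by (simp_all add: as_def qs_def)
      then have ap: "appl M (appl M (val M e' (pr i \<beta> h)) avs) (B # N # Ds) =
          app M (val M e' h) ((B # N # Ds) ! i)"
        if "i < length qs" "typed [] h (qs ! i \<rightarrow> Star \<beta>)" for i \<beta> h
        using val_pr that by blast
      have Sing: "typed [] (Con (cSing \<beta>)) (\<beta> \<rightarrow> Star \<beta>)" for \<beta>
        by (simp add: typed_Con)
      have "app M (val M e' max) N = fset M tyN {natv M (Max (natof M ` els M N))}"
        unfolding max_def using N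
        by (simp add: val_compose_tm[OF assms(1)] typed_Con app_Max[OF assms(1)] app_Sing[OF assms(1)]
            natv_car[OF assms(1)] del: const_val.simps)
      with max have e1: "appl M (appl M (val M e' (pr 1 tyN max)) avs) (B # N # Ds) =
          fset M tyN {natv M (Max (natof M ` els M N))}"
        by (subst ap) (simp_all add: qs_def)
      have e2: "appl M (appl M (val M e' (pr 0 (Star tyN) (Con (cSing (Star tyN))))) avs) (B # N # Ds) =
          fset M (Star tyN) {B}"
        using B by (subst ap) (simp_all add: qs_def Sing app_Sing[OF assms(1)] del: const_val.simps)
      have e3: "appl M (appl M (val M e' (pr (i + 2) (Star (\<beta>s ! i)) (Con (cSing (Star (\<beta>s ! i)))))) avs)
          (B # N # Ds) = fset M (Star (\<beta>s ! i)) {Ds ! i}" if "i < length \<beta>s" for i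
        using that list_all2_nthD2[OF Ds, of i]
        by (subst ap) (simp_all add: qs_def Sing app_Sing[OF assms(1)] del: const_val.simps)
      have "map (\<lambda>i. appl M (appl M (val M e' (pr (i + 2) (Star (\<beta>s ! i))
            (Con (cSing (Star (\<beta>s ! i)))))) avs) (B # N # Ds)) [0..<length \<beta>s] =
          map2 (\<lambda>\<sigma> v. fset M \<sigma> {v}) (map Star \<beta>s) Ds"
        using Ds[THEN list_all2_lengthD] e3 by (intro nth_equalityI) simp_all
      then show "map (\<lambda>g. appl M g (B # N # Ds)) (map (\<lambda>w. appl M (val M e' w) avs) ws) =
        map2 (\<lambda>\<sigma> v. fset M \<sigma> {v}) (tyN # Star tyN # map Star (neg (rel C)))
          (natv M (Max (natof M ` els M N)) # B # Ds)"
        unfolding \<beta>s_def[symmetric] ws_def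
        by (simp add: e1[simplified] e2[simplified] comp_def del: const_val.simps)
    qed
  qed
qed

end
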